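(* Let $\mathbb{T}=\mathbb{R}/2\pi\mathbb{Z}$ and identify $\mathbb{S}^3\simeq\mathrm{SU}(2)$. Let $p_0,\delta\in\mathbb{R}$, $\alpha\in\mathbb{C}\setminus\{0\}$, and $q,s\in C^\infty(\mathbb{T};\mathbb{R})$ with $q\ge 0$ and $q\not\equiv 0$. Let $P:C^\infty(\mathbb{T}\times\mathbb{S}^3)\to C^\infty(\mathbb{T}\times\mathbb{S}^3)$ be the operator $$Pu=\partial_tu+ip_0\partial_0u-(s(t)+i\delta q(t))u-\alpha q(t)\overline{u}.$$ Put $$s_0=\int_0^{2\pi}s(\tau)\,d\tau,\quad q_0=\int_0^{2\pi}q(\tau)\,d\tau,\quad A_0=s_0+i\delta q_0,\quad B_0=\alpha q_0.$$ Say that $(m,k)\in\frac12\mathbb{Z}\times\mathbb{Z}$ is resonant if $$\operatorname{Re}\bigl(A_0(k+mp_0)\bigr)=0\quad\text{and}\quad 4\pi^2|k+mp_0|^2=|A_0|^2-|B_0|^2.$$ Suppose that one of the following conditions holds: (1) $|B_0|>|A_0|$; (2) $|B_0|\le|A_0|$, $|\alpha|>|\delta|$, and there is no resonant $(m,k)\in\frac12\mathbb{Z}\times\mathbb{Z}$; (3) $|\alpha|<|\delta|$ and $s_0\neq 0$; (4) $|\alpha|<|\delta|$, $s_0=0$, there is no resonant $(m,k)\in\frac12\mathbb{Z}\times\mathbb{Z}$, and the following Diophantine condition holds: there exists $M>0$ such that, for all $\ell\in\frac12\mathbb{N}_0$ with $\langle\ell\rangle\ge M$, all $m\in\{-\ell,-\ell+1,\dots,\ell\}$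 and all $k\in\mathbb{Z}$, $$\left|2\pi k+2\pi mp_0-q_0\sqrt{\delta^2-|\alpha|^2}\right|\ge\langle\ell\rangle^{-M}.$$ Then, for every $f\in C^\infty(\mathbb{T}\times\mathbb{S}^3)$, there exists $u\in C^\infty(\mathbb{T}\times\mathbb{S}^3)$ such that $Pu=f$.
   Context: The irreducible unitary representations of $\mathrm{SU}(2)$ are indexed, up to equivalence, by $\ell\in\frac12\mathbb{N}_0$; the representation $\mathsf{t}^\ell$ has dimension $2\ell+1$, with matrix entries $\mathsf{t}^\ell_{mn}$, $m,n\in\{-\ell,-\ell+1,\dots,\ell\}$. The operator $\partial_0$ is the standard left-invariant (complexified) vector field of Fourier analysis on $\mathbb{S}^3$: $\partial_0=iX$, where $X$ is a real left-invariant vector field on $\mathrm{SU}(2)$, with symbol $\sigma_{\partial_0}(\ell)=\mathsf{t}^\ell(x)^*(\partial_0\mathsf{t}^\ell)(x)$ (the operator being applied entrywise) equal to the diagonal matrix $(m\,\delta_{mn})_{m,n}$; in particular its eigenvalues on $\mathsf{t}^\ell$ are exactly $m\in\{-\ell,\dots,\ell\}$. On $\mathbb{T}\times\mathbb{S}^3$ it acts in the $\mathbb{S}^3$-variable. The weight is $\langle\ell\rangle=(1+\nu_\ell)^{1/2}$, where $\nu_\ell=\ell(\ell+1)$ is the eigenvalue of minus the Laplace–Beltrami operator on the matrix entries of $\mathsf{t}^\ell$. *)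

theory Defs
  imports "HOL-Analysis.Analysis"
begin

section \<open>Smooth functions\<close>

primrec Ck_on :: "nat \<Rightarrow> 'a set \<Rightarrow> ('a::real_normed_vector \<Rightarrow> 'b::real_normed_vector) \<Rightarrow> bool"
  where
    "Ck_on 0 U f \<longleftrightarrow> continuous_on U f"
  | "Ck_on (Suc k) U f \<longleftrightarrow>
       (\<forall>x\<in>U. f differentiable (at x)) \<and>
       (\<forall>v. Ck_on k U (\<lambda>x. frechet_derivative f (at x) v))"

text \<open>This is only meant for open \<open>U\<close>.\<close>

definition Cinf_on :: "'a set \<Rightarrow> ('a::real_normed_vector \<Rightarrow> 'b::real_normed_vector) \<Rightarrow> bool"
  where "Cinf_on U f \<longleftrightarrow> (\<forall>k. Ck_on k U f)"

text \<open>A function on an embedded submanifold \<open>M\<close> of a Euclidean space is smooth iff, near every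
  point of \<open>M\<close>, it extends to a smooth function on an open subset of the ambient space.\<close>

definition smooth_submfd ::
    "'a set \<Rightarrow> ('a::euclidean_space \<Rightarrow> 'b::real_normed_vector) \<Rightarrow> bool"
  where "smooth_submfd M f \<longleftrightarrow>
    (\<forall>x\<in>M. \<exists>U g. open U \<and> x \<in> U \<and> Cinf_on U g \<and> (\<forall>y\<in>U \<inter> M. f y = g y))"


section \<open>The group $SU(2)$ and the vector field\<close>

definition adjoint_mat :: "complex^'n^'m \<Rightarrow> complex^'m^'n"
  where "adjoint_mat A = (\<chi> i j. cnj (A $ j $ i))"

definition SU2 :: "(complex^2^2) set"
  where "SU2 = {A. A ** adjoint_mat A = mat 1 \<and> det A = 1}"

text \<open>The one-parameter subgroup $\mathrm{diag}(e^{i\tau/2}, e^{-i\tau/2})$.\<close>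

definition w3 :: "real \<Rightarrow> complex^2^2"
  where "w3 \<tau> = (\<chi> i j. if i \<noteq> j then 0 else if i = 1 then cis (\<tau> / 2) else cis (- \<tau> / 2))"

text \<open>$\partial_0 = iX$, where $X$ is the left-invariant vector field generated by \<open>w3\<close>.\<close>

definition partial0 :: "(complex^2^2 \<Rightarrow> complex) \<Rightarrow> complex^2^2 \<Rightarrow> complex"
  where "partial0 f x = \<i> * vector_derivative (\<lambda>\<tau>. f (x ** w3 \<tau>)) (at 0)"

lemma w3_in_SU2: "w3 \<tau> \<in> SU2"
  by (simp add: SU2_def w3_def adjoint_mat_def matrix_matrix_mult_def mat_def vec_eq_iff
      forall_2 sum_2 det_2 cis_mult cis_cnj)

lemma w3_add: "w3 (\<sigma> + \<tau>) = w3 \<sigma> ** w3 \<tau>"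
  by (simp add: w3_def matrix_matrix_mult_def vec_eq_iff forall_2 sum_2 cis_mult
      add_divide_distrib diff_divide_distrib)

text \<open>Normalisation of $\partial_0$: $\mathsf t^\ell$ is realised on the homogeneous polynomials of
  degree $2\ell$ in \<open>z\<close> by $(\mathsf t^\ell(x)p)(z) = p(zx)$, with weight basis
  $z_1^{\ell-m} z_2^{\ell+m}$ up to scalars. With $a = \ell-m$ and $b = \ell+m$ the lemma says that
  column \<open>m\<close> of $\mathsf t^\ell$ consists of eigenfunctions of $\partial_0$ for the eigenvalue
  $(b-a)/2 = m$, i.e. $\sigma_{\partial_0}(\ell) = (m\,\delta_{mn})$.\<close>

lemma partial0_weight:
  fixes z :: "complex^2" and x :: "complex^2^2" and a b :: nat
  shows "partial0 (\<lambda>y. (z v* y) $ 1 ^ a * (z v* y) $ 2 ^ b) x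
       = of_real ((real b - real a) / 2) * ((z v* x) $ 1 ^ a * (z v* x) $ 2 ^ b)"
proof -
  define c where "c = (z v* x) $ 1 ^ a * (z v* x) $ 2 ^ b"
  have 1: "(z v* (x ** w3 \<tau>)) $ 1 = (z v* x) $ 1 * cis (\<tau> / 2)" for \<tau>
    by (simp add: vector_matrix_mult_def matrix_matrix_mult_def w3_def sum_2 algebra_simps)
  have 2: "(z v* (x ** w3 \<tau>)) $ 2 = (z v* x) $ 2 * cis (- \<tau> / 2)" for \<tau>
    by (simp add: vector_matrix_mult_def matrix_matrix_mult_def w3_def sum_2 algebra_simps)
  have 3: "(z v* (x ** w3 \<tau>)) $ 1 ^ a * (z v* (x ** w3 \<tau>)) $ 2 ^ b
      = c * exp (\<tau> *\<^sub>R (of_real ((real a - real b) / 2) * \<i>))" for \<tau>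
  proof -
    have e: "cis (\<tau> / 2) ^ a * cis (- \<tau> / 2) ^ b
        = exp (\<tau> *\<^sub>R (of_real ((real a - real b) / 2) * \<i>))"
      by (simp only: cis_conv_exp exp_of_nat_mult [symmetric] exp_add [symmetric])
        (rule arg_cong[of _ _ exp], simp add: scaleR_conv_of_real field_simps)
    show ?thesis
      unfolding 1 2 c_def power_mult_distrib e [symmetric] by (simp only: mult_ac)
  qed
  have "((\<lambda>\<tau>. c * exp (\<tau> *\<^sub>R (of_real ((real a - real b) / 2) * \<i>))) has_vector_derivative
      c * (exp (0 *\<^sub>R (of_real ((real a - real b) / 2) * \<i>))
        * (of_real ((real a - real b) / 2) * \<i>))) (at 0)"
    by (intro has_vector_derivative_mult_right exp_scaleR_has_vector_derivative_right)
  then have "partial0 (\<lambda>y. (z v* y) $ 1 ^ a * (z v* y) $ 2 ^ b) x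
      = \<i> * (c * (of_real ((real a - real b) / 2) * \<i>))"
    unfolding partial0_def 3 by (subst vector_derivative_at) auto
  then show ?thesis
    by (simp add: c_def[symmetric] field_simps)
qed


section \<open>Function spaces and the operator\<close>

text \<open>Functions on $\mathbb T = \mathbb R/2\pi\mathbb Z$ are rendered as $2\pi$-periodic functions
  on $\mathbb R$. Elements of \<open>Cinf_T_SU2\<close> are total functions on the ambient space, of which only
  the values on \<open>UNIV \<times> SU2\<close> are meaningful.\<close>

definition Cinf_T :: "(real \<Rightarrow> real) set"
  where "Cinf_T = {q. (\<forall>t. q (t + 2 * pi) = q t) \<and> Cinf_on UNIV q}"

definition Cinf_T_SU2 :: "(real \<times> (complex^2^2) \<Rightarrow> complex) set"
  where "Cinf_T_SU2 =
    {u. (\<forall>t. \<forall>x\<in>SU2. u (t + 2 * pi, x) = u (t, x)) \<and> smooth_submfd (UNIV \<times> SU2) u}"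

definition operator_P ::
    "real \<Rightarrow> real \<Rightarrow> complex \<Rightarrow> (real \<Rightarrow> real) \<Rightarrow> (real \<Rightarrow> real) \<Rightarrow>
     (real \<times> (complex^2^2) \<Rightarrow> complex) \<Rightarrow> real \<times> (complex^2^2) \<Rightarrow> complex"
  where "operator_P p0 \<delta> \<alpha> q s u = (\<lambda>(t, x).
      vector_derivative (\<lambda>\<tau>. u (\<tau>, x)) (at t)
      + \<i> * of_real p0 * partial0 (\<lambda>y. u (t, y)) x
      - (of_real (s t) + \<i> * of_real \<delta> * of_real (q t)) * u (t, x)
      - \<alpha> * of_real (q t) * cnj (u (t, x)))"


section \<open>Half-integers, weights and resonances\<close>

definition half_ints :: "real set"
  where "half_ints = range (\<lambda>j::int. of_int j / 2)"

definition half_nats :: "real set"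
  where "half_nats = range (\<lambda>n::nat. of_nat n / 2)"

definition weights :: "real \<Rightarrow> real set"
  where "weights l = {- l + of_nat j | j::nat. of_nat j \<le> 2 * l}"

definition jbracket :: "real \<Rightarrow> real"
  where "jbracket l = sqrt (1 + l * (l + 1))"

definition resonant :: "real \<Rightarrow> complex \<Rightarrow> complex \<Rightarrow> real \<Rightarrow> int \<Rightarrow> bool"
  where "resonant p0 A0 B0 m k \<longleftrightarrow>
    Re (A0 * of_real (of_int k + m * p0)) = 0 \<and>
    4 * pi\<^sup>2 * \<bar>of_int k + m * p0\<bar>\<^sup>2 = (cmod A0)\<^sup>2 - (cmod B0)\<^sup>2"

end

theory Submission
  imports Defs
begin

text \<open>The first-order part of \<open>P\<close> is the real vector field \<open>\<partial>\<^sub>t - p0 X\<close>, whose flow shifts \<open>t\<close> and rotates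
  \<open>x\<close> by the one-parameter group \<open>w3\<close>. Treating \<open>u\<close> and its conjugate as independent unknowns and
  diagonalising the zero-order part gives two scalar linear ODEs along the flow. Their solutions
  close up over a period of \<open>t\<close> iff their values at \<open>t = 0\<close> solve a cohomological equation
  \<open>v (R x) - \<lambda> v x = G x\<close> with \<open>R\<close> a rotation by \<open>w3\<close>. This is solved by Fourier series along the
  \<open>w3\<close>-orbits, the divisors being \<open>exp (2 \<pi> \<i> m p0) - \<lambda>\<close> with half-integer \<open>m\<close>: they stay away from \<open>0\<close> if
  \<open>\<bar>\<lambda>\<bar> \<noteq> 1\<close>, which is what conditions (1) to (3) amount to, and (4) bounds them
  below by a power of \<open>m\<close>. No representation theory of \<open>SU(2)\<close> is needed. All functions are extended to
  the open set of matrices with non-zero first row by means of a smooth retraction onto \<open>SU(2)\<close>, so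
  that smoothness is the ordinary one.\<close>

section \<open>Calculus of smooth functions\<close>

lemma Ck_on_cong:
  assumes "open S" "\<And>x. x \<in> S \<Longrightarrow> f x = g x" "Ck_on k S f"
  shows "Ck_on k S g"
  using assms(2,3)
proof (induction k arbitrary: f g)
  case 0
  then show ?case
    by (metis Ck_on.simps(1) continuous_on_cong)
next
  case (Suc k)
  have D: "(g has_derivative frechet_derivative f (at x)) (at x)" if "x \<in> S" for x
  proof (rule has_derivative_transform_within_open[where f = f and s = S])
    show "(f has_derivative frechet_derivative f (at x)) (at x)"
      using Suc.prems(2) that by (simp add: frechet_derivative_works[symmetric])
  qed (use Suc.prems(1) that assms(1) in auto)
  then have "g differentiable at x" if "x \<in> S" for x
    using that unfolding differentiable_def by blast
  moreover have "Ck_on k S (\<lambda>x. frechet_derivative g (at x) v)" for v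
  proof (rule Suc.IH)
    show "Ck_on k S (\<lambda>x. frechet_derivative f (at x) v)"
      using Suc.prems(2) by simp
    show "frechet_derivative f (at x) v = frechet_derivative g (at x) v" if "x \<in> S" for x
      using frechet_derivative_at[OF D[OF that]] by simp
  qed
  ultimately show ?case by simp
qed

text \<open>\<open>frechet_derivative\<close> is a choice operator; since derivatives are unique,
  any explicit formula for the derivative may replace it. Most closure properties below are
  inductions on \<open>k\<close> through this rule.\<close>

lemma Ck_on_SucI:
  assumes "open S"
    and D: "\<And>x. x \<in> S \<Longrightarrow> (f has_derivative f' x) (at x)"
    and "\<And>v. Ck_on k S (\<lambda>x. f' x v)"
  shows "Ck_on (Suc k) S f"
proof -
  have "Ck_on k S (\<lambda>x. frechet_derivative f (at x) v)" for v
    by (rule Ck_on_cong[OF assms(1) _ assms(3)[of v]]) (simp add: frechet_derivative_at[OF D])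
  moreover have "f differentiable at x" if "x \<in> S" for x
    using D[OF that] unfolding differentiable_def by blast
  ultimately show ?thesis by simp
qed

lemma Ck_on_SucD:
  assumes "Ck_on (Suc k) S f"
  shows "x \<in> S \<Longrightarrow> (f has_derivative frechet_derivative f (at x)) (at x)"
    and "Ck_on k S (\<lambda>x. frechet_derivative f (at x) v)"
  using assms by (auto simp: frechet_derivative_works[symmetric])

lemma Ck_on_Suc_imp: "Ck_on (Suc k) S f \<Longrightarrow> Ck_on k S f"
proof (induction k arbitrary: f)
  case 0
  then show ?case
    by (auto intro!: continuous_at_imp_continuous_on differentiable_imp_continuous_within)
next
  case (Suc k)
  then show ?case by (metis Ck_on.simps(2))
qed

lemma Ck_on_imp_continuous_on: "Ck_on k S f \<Longrightarrow> continuous_on S f"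
  by (induction k) (auto dest: Ck_on_Suc_imp simp del: Ck_on.simps(2))

lemma Ck_on_subset: "Ck_on k S f \<Longrightarrow> T \<subseteq> S \<Longrightarrow> Ck_on k T f"
  by (induction k arbitrary: f) (auto intro: continuous_on_subset)

lemma Ck_on_local:
  assumes "\<And>x. x \<in> S \<Longrightarrow> \<exists>V. open V \<and> x \<in> V \<and> Ck_on k V f"
  shows "Ck_on k S f"
  using assms
proof (induction k arbitrary: f)
  case 0
  have "isCont f x" if x: "x \<in> S" for x
    using 0[OF x] by (auto simp: continuous_on_eq_continuous_at)
  then show ?case
    by (simp add: continuous_at_imp_continuous_on)
next
  case (Suc k)
  have "f differentiable at x" if "x \<in> S" for x
    using Suc.prems[OF that] by auto
  moreover have "Ck_on k S (\<lambda>x. frechet_derivative f (at x) v)" for v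
    by (rule Suc.IH) (use Suc.prems in fastforce)
  ultimately show ?case by simp
qed

lemma Ck_on_const: "open S \<Longrightarrow> Ck_on k S (\<lambda>x. c)"
proof (induction k arbitrary: c)
  case (Suc k)
  then show ?case
    by (intro Ck_on_SucI[where f' = "\<lambda>x h. 0"]) auto
qed auto

lemma Ck_on_bounded_linear:
  assumes "open S" "bounded_linear L" "Ck_on k S f"
  shows "Ck_on k S (\<lambda>x. L (f x))"
  using assms(3)
proof (induction k arbitrary: f)
  case 0
  then show ?case
    using assms(2) by (auto intro: bounded_linear.continuous_on)
next
  case (Suc k)
  show ?case
    by (rule Ck_on_SucI[OF assms(1) bounded_linear.has_derivative[OF assms(2) Ck_on_SucD(1)[OF Suc.prems]]])
      (use Suc in auto)
qed

lemma Ck_on_ident: "open S \<Longrightarrow> Ck_on k S (\<lambda>x. x)"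
proof (cases k)
  case (Suc k')
  assume "open S"
  then have "Ck_on (Suc k') S (\<lambda>x. x)"
    by (intro Ck_on_SucI[where f' = "\<lambda>x h. h"] has_derivative_ident Ck_on_const)
  then show ?thesis using Suc by metis
qed auto

lemma Ck_on_linear: "open S \<Longrightarrow> bounded_linear L \<Longrightarrow> Ck_on k S L"
  using Ck_on_bounded_linear[OF _ _ Ck_on_ident] .

lemma Ck_on_add:
  assumes "open S" "Ck_on k S f" "Ck_on k S g"
  shows "Ck_on k S (\<lambda>x. f x + g x)"
  using assms(2,3)
proof (induction k arbitrary: f g)
  case 0
  then show ?case by (auto intro: continuous_intros)
next
  case (Suc k)
  show ?case
    by (rule Ck_on_SucI[OF assms(1) has_derivative_add[OF Ck_on_SucD(1)[OF Suc.prems(1)] Ck_on_SucD(1)[OF Suc.prems(2)]]])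
      (use Suc in auto)
qed

lemma Ck_on_sum:
  assumes "open S" "\<And>i. i \<in> I \<Longrightarrow> Ck_on k S (f i)"
  shows "Ck_on k S (\<lambda>x. \<Sum>i\<in>I. f i x)"
  using assms(2)
  by (induction I rule: infinite_finite_induct) (auto intro!: Ck_on_const Ck_on_add assms(1))

lemma Ck_on_bilinear:
  assumes "open S" "bounded_bilinear B" "Ck_on k S f" "Ck_on k S g"
  shows "Ck_on k S (\<lambda>x. B (f x) (g x))"
  using assms(3,4)
proof (induction k arbitrary: f g)
  case 0
  then show ?case
    using assms(2) by (auto intro: bounded_bilinear.continuous_on)
next
  case (Suc k)
  show ?case
  proof (rule Ck_on_SucI[OF assms(1) bounded_bilinear.FDERIV[OF assms(2) Ck_on_SucD(1)[OF Suc.prems(1)] Ck_on_SucD(1)[OF Suc.prems(2)]]])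
    fix v
    show "Ck_on k S (\<lambda>x. B (f x) (frechet_derivative g (at x) v) + B (frechet_derivative f (at x) v) (g x))"
      by (intro Ck_on_add assms(1) Suc.IH Ck_on_SucD(2) Suc.prems Ck_on_Suc_imp)
  qed
qed

lemma linear_euclidean_sum:
  fixes D :: "'a::euclidean_space \<Rightarrow> 'b::real_vector"
  assumes "linear D"
  shows "D w = (\<Sum>b\<in>Basis. (w \<bullet> b) *\<^sub>R D b)"
  by (subst euclidean_representation[of w, symmetric])
    (simp only: linear_sum[OF assms] linear_scale[OF assms])

text \<open>The chain rule differentiates \<open>f\<close> in the direction Dg(x)v, which varies
  with \<open>x\<close>, whereas \<open>Ck_on\<close> speaks of fixed directions. Expanding that
  direction in \<open>Basis\<close> leaves finitely many fixed ones; this is why the intermediate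
  space is Euclidean.\<close>

lemma Ck_on_compose:
  fixes f :: "'b::euclidean_space \<Rightarrow> 'c::real_normed_vector"
  assumes "open S" "open T" "\<And>x. x \<in> S \<Longrightarrow> g x \<in> T" "Ck_on k T f" "Ck_on k S g"
  shows "Ck_on k S (\<lambda>x. f (g x))"
  using assms(4,5)
proof (induction k arbitrary: f)
  case 0
  then show ?case
    using assms(3) by (auto intro: continuous_on_compose2)
next
  case (Suc k)
  have f: "(f has_derivative frechet_derivative f (at (g x))) (at (g x))" if "x \<in> S" for x
    by (rule Ck_on_SucD(1)[OF Suc.prems(1)]) (use assms(3) that in auto)
  show ?case
  proof (rule Ck_on_SucI[OF assms(1) has_derivative_compose[OF Ck_on_SucD(1)[OF Suc.prems(2)] f]])
    fix v
    have "Ck_on k S (\<lambda>x. \<Sum>b\<in>Basis. (frechet_derivative g (at x) v \<bullet> b) *\<^sub>R frechet_derivative f (at (g x)) b)"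
      by (intro Ck_on_sum assms(1) Ck_on_bilinear[OF _ bounded_bilinear_scaleR]
          Ck_on_bounded_linear[OF _ bounded_linear_inner_left] Suc.IH Ck_on_SucD(2) Suc.prems Ck_on_Suc_imp)
    then show "Ck_on k S (\<lambda>x. frechet_derivative f (at (g x)) (frechet_derivative g (at x) v))"
      by (rule Ck_on_cong[OF assms(1), rotated])
        (use linear_euclidean_sum[OF has_derivative_linear[OF f]] in auto)
  qed
qed

text \<open>Differentiation along a vector field \<open>w\<close>; again the moving direction is
  expanded in \<open>Basis\<close>. Through this the generator of a circle action preserves
  smoothness.\<close>

lemma Ck_on_frechet_apply:
  fixes f :: "'a::euclidean_space \<Rightarrow> 'c::real_normed_vector"
  assumes "open S" "Ck_on (Suc k) S f" "Ck_on k S w"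
  shows "Ck_on k S (\<lambda>x. frechet_derivative f (at x) (w x))"
proof -
  have "Ck_on k S (\<lambda>x. \<Sum>b\<in>Basis. (w x \<bullet> b) *\<^sub>R frechet_derivative f (at x) b)"
    by (intro Ck_on_sum assms(1) Ck_on_bilinear[OF _ bounded_bilinear_scaleR]
          Ck_on_bounded_linear[OF _ bounded_linear_inner_left] Ck_on_SucD(2) assms)
  then show ?thesis
    by (rule Ck_on_cong[OF assms(1), rotated])
      (use linear_euclidean_sum[OF has_derivative_linear[OF Ck_on_SucD(1)[OF assms(2)]]] in auto)
qed

lemma Ck_on_Pair:
  assumes "open S" "Ck_on k S f" "Ck_on k S g"
  shows "Ck_on k S (\<lambda>x. (f x, g x))"
  using assms(2,3)
proof (induction k arbitrary: f g)
  case 0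
  then show ?case by (auto intro: continuous_intros)
next
  case (Suc k)
  show ?case
    by (rule Ck_on_SucI[OF assms(1) has_derivative_Pair[OF Ck_on_SucD(1)[OF Suc.prems(1)] Ck_on_SucD(1)[OF Suc.prems(2)]]])
      (use Suc in auto)
qed

lemma Ck_on_real:
  fixes f :: "real \<Rightarrow> 'b::real_normed_vector"
  assumes "open S" "\<And>x. x \<in> S \<Longrightarrow> (f has_vector_derivative f' x) (at x)" "Ck_on k S f'"
  shows "Ck_on (Suc k) S f"
  by (rule Ck_on_SucI[OF assms(1), where f' = "\<lambda>x h. h *\<^sub>R f' x"])
    (use assms(2) in \<open>auto simp: has_vector_derivative_def
      intro!: Ck_on_bounded_linear[OF assms(1) bounded_linear_scaleR_right assms(3)]\<close>)

section \<open>Smooth functions: closure properties inherited from the finite orders\<close>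

lemma Cinf_on_imp_Ck_on: "Cinf_on S f \<Longrightarrow> Ck_on k S f"
  by (simp add: Cinf_on_def)

lemma Cinf_on_has_derivative:
  "Cinf_on S f \<Longrightarrow> x \<in> S \<Longrightarrow> (f has_derivative frechet_derivative f (at x)) (at x)"
  using Ck_on_SucD(1) Cinf_on_imp_Ck_on by blast

lemma Cinf_on_imp_continuous_on: "Cinf_on S f \<Longrightarrow> continuous_on S f"
  using Ck_on_imp_continuous_on Cinf_on_imp_Ck_on by blast

lemma Cinf_on_subset: "Cinf_on S f \<Longrightarrow> T \<subseteq> S \<Longrightarrow> Cinf_on T f"
  unfolding Cinf_on_def using Ck_on_subset by blast

lemma Cinf_on_cong: "open S \<Longrightarrow> (\<And>x. x \<in> S \<Longrightarrow> f x = g x) \<Longrightarrow> Cinf_on S f \<Longrightarrow> Cinf_on S g"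
  unfolding Cinf_on_def using Ck_on_cong by blast

lemma Cinf_on_local:
  "(\<And>x. x \<in> S \<Longrightarrow> \<exists>V. open V \<and> x \<in> V \<and> Cinf_on V f) \<Longrightarrow> Cinf_on S f"
  unfolding Cinf_on_def using Ck_on_local by meson

lemma Cinf_on_const: "open S \<Longrightarrow> Cinf_on S (\<lambda>x. c)"
  by (simp add: Cinf_on_def Ck_on_const)

lemma Cinf_on_linear: "open S \<Longrightarrow> bounded_linear L \<Longrightarrow> Cinf_on S L"
  by (simp add: Cinf_on_def Ck_on_linear)

lemma Cinf_on_bounded_linear:
  "open S \<Longrightarrow> bounded_linear L \<Longrightarrow> Cinf_on S f \<Longrightarrow> Cinf_on S (\<lambda>x. L (f x))"
  by (simp add: Cinf_on_def Ck_on_bounded_linear)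

lemma Cinf_on_bilinear:
  "open S \<Longrightarrow> bounded_bilinear B \<Longrightarrow> Cinf_on S f \<Longrightarrow> Cinf_on S g \<Longrightarrow> Cinf_on S (\<lambda>x. B (f x) (g x))"
  by (simp add: Cinf_on_def Ck_on_bilinear)

lemmas Cinf_on_scaleR = Cinf_on_bilinear[OF _ bounded_bilinear_scaleR]

lemma Cinf_on_mult:
  fixes f g :: "_ \<Rightarrow> 'b::real_normed_algebra"
  shows "open S \<Longrightarrow> Cinf_on S f \<Longrightarrow> Cinf_on S g \<Longrightarrow> Cinf_on S (\<lambda>x. f x * g x)"
  using Cinf_on_bilinear[OF _ bounded_bilinear_mult] .

lemma Cinf_on_add:
  "open S \<Longrightarrow> Cinf_on S f \<Longrightarrow> Cinf_on S g \<Longrightarrow> Cinf_on S (\<lambda>x. f x + g x)"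
  by (simp add: Cinf_on_def Ck_on_add)

lemma Cinf_on_minus: "open S \<Longrightarrow> Cinf_on S f \<Longrightarrow> Cinf_on S (\<lambda>x. - f x)"
  by (rule Cinf_on_bounded_linear[OF _ bounded_linear_minus[OF bounded_linear_ident]])

lemma Cinf_on_diff:
  "open S \<Longrightarrow> Cinf_on S f \<Longrightarrow> Cinf_on S g \<Longrightarrow> Cinf_on S (\<lambda>x. f x - g x)"
  using Cinf_on_add[OF _ _ Cinf_on_minus, of S f g] by simp

lemma Cinf_on_Pair:
  "open S \<Longrightarrow> Cinf_on S f \<Longrightarrow> Cinf_on S g \<Longrightarrow> Cinf_on S (\<lambda>x. (f x, g x))"
  by (simp add: Cinf_on_def Ck_on_Pair)

lemma Cinf_on_compose:
  fixes f :: "'b::euclidean_space \<Rightarrow> 'c::real_normed_vector"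
  assumes "Cinf_on T f" "open S" "open T" "Cinf_on S g" "\<And>x. x \<in> S \<Longrightarrow> g x \<in> T"
  shows "Cinf_on S (\<lambda>x. f (g x))"
  using assms by (simp add: Cinf_on_def Ck_on_compose)

lemma Cinf_on_frechet_apply:
  fixes f :: "'a::euclidean_space \<Rightarrow> 'c::real_normed_vector"
  assumes "open S" "Cinf_on S f" "Cinf_on S w"
  shows "Cinf_on S (\<lambda>x. frechet_derivative f (at x) (w x))"
  using assms unfolding Cinf_on_def by (blast intro: Ck_on_frechet_apply)

lemmas Cinf_on_intros = Cinf_on_const Cinf_on_scaleR Cinf_on_mult Cinf_on_add Cinf_on_minus
  Cinf_on_diff Cinf_on_Pair
  Cinf_on_linear[OF _ bounded_linear_fst] Cinf_on_linear[OF _ bounded_linear_snd]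
  Cinf_on_linear[OF _ bounded_linear_ident]

section \<open>Smoothness of sine, cosine, real powers and exponentials of primitives\<close>

lemma Cinf_on_sin_shift: "Cinf_on UNIV (\<lambda>x::real. sin (x + c))"
proof -
  have "Ck_on k UNIV (\<lambda>x::real. sin (x + c))" for k
  \<comment> \<open>Differentiating sine advances it by a quarter period, so the claim for all
    shifts \<open>c\<close> reproduces itself.\<close>
  proof (induction k arbitrary: c)
    case 0
    show ?case by (auto intro!: continuous_intros)
  next
    case (Suc k)
    have "((\<lambda>x. sin (x + c)) has_vector_derivative sin (x + (c + pi / 2))) (at x)" for x
    proof -
      have "((\<lambda>x. sin (x + c)) has_real_derivative cos (x + c)) (at x)"
        by (auto intro!: derivative_eq_intros)
      moreover have "cos (x + c) = sin (x + (c + pi / 2))"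
        by (simp add: sin_add flip: add.assoc)
      ultimately show ?thesis
        by (simp add: has_real_derivative_iff_has_vector_derivative)
    qed
    then show ?case
      by (rule Ck_on_real[OF open_UNIV _ Suc])
  qed
  then show ?thesis by (simp add: Cinf_on_def)
qed

lemma Cinf_on_sin: "Cinf_on UNIV (sin :: real \<Rightarrow> real)"
  using Cinf_on_sin_shift[of 0] by simp

lemma Cinf_on_cos: "Cinf_on UNIV (cos :: real \<Rightarrow> real)"
  using Cinf_on_sin_shift[of "pi / 2"] by (simp add: sin_add)

lemma Cinf_on_powr: "Cinf_on {0<..} (\<lambda>x::real. x powr a)"
proof -
  have "Ck_on k {0<..} (\<lambda>x::real. x powr a)" for k
  proof (induction k arbitrary: a)
    case 0
    show ?case by (auto intro!: continuous_intros)
  next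
    case (Suc k)
    show ?case
    proof (rule Ck_on_real[OF open_greaterThan])
      show "((\<lambda>x. x powr a) has_vector_derivative a *\<^sub>R (x powr (a - 1))) (at x)" if "x \<in> {0<..}" for x
        using has_real_derivative_powr[of x a] that
        by (simp add: has_real_derivative_iff_has_vector_derivative)
    qed (intro Ck_on_bounded_linear[OF _ bounded_linear_scaleR_right] Suc open_greaterThan)
  qed
  then show ?thesis by (simp add: Cinf_on_def)
qed

text \<open>The derivative is \<open>f\<close> times the function itself, so each order of
  smoothness yields the next.\<close>

lemma Cinf_on_exp_primitive:
  fixes F f :: "real \<Rightarrow> complex"
  assumes "\<And>t. (F has_vector_derivative f t) (at t)" "Cinf_on UNIV f"
  shows "Cinf_on UNIV (\<lambda>t. exp (F t))"
proof -
  have D: "((\<lambda>t. exp (F t)) has_vector_derivative f t * exp (F t)) (at t)" for t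
    using field_vector_diff_chain_at[OF assms(1) DERIV_exp] by (simp add: o_def)
  have "Ck_on k UNIV (\<lambda>t. exp (F t))" for k
  proof (induction k)
    case 0
    show ?case
      using D by (auto intro!: continuous_at_imp_continuous_on has_vector_derivative_continuous)
  next
    case (Suc k)
    show ?case
      by (rule Ck_on_real[OF open_UNIV D])
        (intro Ck_on_bilinear[OF open_UNIV bounded_bilinear_mult] Suc Cinf_on_imp_Ck_on[OF assms(2)])
  qed
  then show ?thesis by (simp add: Cinf_on_def)
qed

text \<open>Differentiation under the integral sign. All derivatives fall on \<open>H\<close> and
  the result has the same shape, so the induction closes with a merely continuous weight
  \<open>K\<close>, such as the kernel from \<open>multiplier_kernel\<close>.\<close>

lemma Ck_on_integral_param:
  fixes H :: "real \<times> 'a::euclidean_space \<Rightarrow> complex"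
  assumes "open S" "continuous_on {a..b} K" "Ck_on k (UNIV \<times> S) H"
  shows "Ck_on k S (\<lambda>x. integral {a..b} (\<lambda>\<tau>. K \<tau> * H (\<tau>, x)))"
  using assms(3)
proof (induction k arbitrary: H)
  case 0
  have "continuous_on (S \<times> cbox a b) (\<lambda>(x, \<tau>). K \<tau> * H (\<tau>, x))"
    unfolding split_beta
    by (intro continuous_intros continuous_on_compose2[OF assms(2)]
        continuous_on_compose2[OF Ck_on_imp_continuous_on[OF 0]]) auto
  from integral_continuous_on_param[OF this] show ?case by simp
next
  case (Suc k)
  have SS: "open (UNIV \<times> S :: (real \<times> 'a) set)"
    using assms(1) by (simp add: open_Times)
  let ?D = "\<lambda>x \<tau> v. K \<tau> * frechet_derivative H (at (\<tau>, x)) (0, v)"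
  \<comment> \<open>\<open>leibniz_rule\<close> wants the derivative in the parameter as a
    continuous family of bounded linear operators.\<close>
  define fx where "fx x \<tau> = Blinfun (?D x \<tau>)" for x \<tau>
  have fx: "blinfun_apply (fx x \<tau>) = ?D x \<tau>" if "x \<in> S" for x \<tau>
    unfolding fx_def
  proof (rule bounded_linear_Blinfun_apply)
    have "bounded_linear (\<lambda>v. (0::real, v::'a))"
      by (intro bounded_linear_Pair bounded_linear_zero bounded_linear_ident)
    from bounded_linear_compose[OF has_derivative_bounded_linear[OF Ck_on_SucD(1)[OF Suc.prems]] this]
    show "bounded_linear (?D x \<tau>)"
      by (intro bounded_linear_const_mult) (use that in auto)
  qed
  have D: "((\<lambda>x. integral (cbox a b) (\<lambda>\<tau>. K \<tau> * H (\<tau>, x))) has_derivative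
      (\<lambda>v. integral {a..b} (\<lambda>\<tau>. ?D x \<tau> v))) (at x)" if x: "x \<in> S" for x
  proof -
    obtain e where e: "e > 0" "ball x e \<subseteq> S"
      using assms(1) x by (auto simp: open_contains_ball)
    have cont: "continuous_on (S \<times> cbox a b) (\<lambda>(x, \<tau>). fx x \<tau>)"
      unfolding split_beta
    proof (rule continuous_on_blinfun_componentwise)
      fix i :: 'a
      have "continuous_on (S \<times> cbox a b) (\<lambda>z. ?D (fst z) (snd z) i)"
        by (intro continuous_intros continuous_on_compose2[OF assms(2)]
            continuous_on_compose2[OF Ck_on_imp_continuous_on[OF Ck_on_SucD(2)[OF Suc.prems]]]) auto
      then show "continuous_on (S \<times> cbox a b) (\<lambda>z. blinfun_apply (fx (fst z) (snd z)) i)"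
        by (rule continuous_on_eq) (auto simp: fx)
    qed
    have "((\<lambda>x. integral (cbox a b) (\<lambda>\<tau>. K \<tau> * H (\<tau>, x))) has_derivative
        blinfun_apply (integral (cbox a b) (fx x))) (at x within ball x e)"
    proof (rule leibniz_rule)
      fix y \<tau> assume y: "y \<in> ball x e" and \<tau>: "\<tau> \<in> cbox a b"
      have "((\<lambda>y. (\<tau>, y)) has_derivative (\<lambda>v. (0, v))) (at y within ball x e)"
        by (auto intro!: derivative_eq_intros)
      from has_derivative_compose[OF this Ck_on_SucD(1)[OF Suc.prems]]
      have "((\<lambda>y. H (\<tau>, y)) has_derivative (\<lambda>v. frechet_derivative H (at (\<tau>, y)) (0, v)))
        (at y within ball x e)"
        using y e by auto
      then show "((\<lambda>y. K \<tau> * H (\<tau>, y)) has_derivative blinfun_apply (fx y \<tau>)) (at y within ball x e)"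
        using y e by (subst fx) (auto intro!: has_derivative_mult_right)
    next
      fix y assume y: "y \<in> ball x e"
      then show "(\<lambda>\<tau>. K \<tau> * H (\<tau>, y)) integrable_on cbox a b"
        using e by (intro integrable_continuous continuous_intros continuous_on_compose2[OF assms(2)]
        continuous_on_compose2[OF Ck_on_imp_continuous_on[OF Suc.prems]]) auto
    next
      show "continuous_on (ball x e \<times> cbox a b) (\<lambda>(x, \<tau>). fx x \<tau>)"
        by (rule continuous_on_subset[OF cont]) (use e in auto)
    qed (use e in auto)
    \<comment> \<open>Evaluation at \<open>v\<close> commutes with the integral, which brings the
      derivative into the form covered by the induction hypothesis.\<close>
    moreover have "blinfun_apply (integral (cbox a b) (fx x)) = (\<lambda>v. integral {a..b} (\<lambda>\<tau>. ?D x \<tau> v))"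
    proof
      fix v
      have "continuous_on (cbox a b) (fx x)"
        using continuous_on_compose2[OF cont, of "cbox a b" "\<lambda>\<tau>. (x, \<tau>)"] x
        by (simp add: continuous_on_Pair image_subset_iff)
      then have "fx x integrable_on cbox a b"
        by (rule integrable_continuous)
      then show "blinfun_apply (integral (cbox a b) (fx x)) v = integral {a..b} (\<lambda>\<tau>. ?D x \<tau> v)"
        by (simp add: blinfun_apply_integral fx x)
    qed
    ultimately show ?thesis
      using e by (simp add: at_within_open[of x "ball x e"])
  qed
  show ?case
    by (rule Ck_on_SucI[OF assms(1) D[unfolded interval_cbox[symmetric]]])
     (auto intro!: Suc.IH Ck_on_SucD(2) Suc.prems)
qed

lemma Cinf_on_integral_param:
  fixes H :: "real \<times> 'a::euclidean_space \<Rightarrow> complex"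
  assumes "open S" "continuous_on {a..b} K" "Cinf_on (UNIV \<times> S) H"
  shows "Cinf_on S (\<lambda>x. integral {a..b} (\<lambda>\<tau>. K \<tau> * H (\<tau>, x)))"
  using assms by (simp add: Cinf_on_def Ck_on_integral_param)

section \<open>Fourier coefficients of periodic functions\<close>

text \<open>The unit interval as domain of integration makes this depend on \<open>t\<close> as on any other
  parameter, and avoids empty intervals for negative \<open>t\<close>.\<close>

definition prim :: "(real \<Rightarrow> 'b::banach) \<Rightarrow> real \<Rightarrow> 'b"
  where "prim F t = integral {0..1} (\<lambda>\<sigma>. t *\<^sub>R F (t * \<sigma>))"

lemma prim_0 [simp]: "prim F 0 = 0"
  by (simp add: prim_def)

lemma prim_has_vector_derivative:
  fixes F :: "real \<Rightarrow> 'b::banach"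
  assumes "continuous_on UNIV F"
  shows "(prim F has_vector_derivative F t) (at t)"
proof -
  \<comment> \<open>The base point \<open>- a\<close> lies to the left of 0 and \<open>t\<close>, so
    \<open>P\<close> is an ordinary primitive near both; the substitution
    \<open>s * \<sigma>\<close> then identifies \<open>prim F s\<close> with
    \<open>P s - P 0\<close>.\<close>
  define a where "a = \<bar>t\<bar> + 1"
  define P where "P s = integral {-a..s} F" for s
  have P: "(P has_vector_derivative F s) (at s)" if "-a < s" "s < a" for s
  proof -
    have "(P has_vector_derivative F s) (at s within {-a..a})"
      unfolding P_def
      by (rule integral_has_vector_derivative) (use that in \<open>auto intro: continuous_on_subset[OF assms]\<close>)
    then show ?thesis
      using that by (subst (asm) at_within_interior) auto
  qed
  have eq: "P s - P 0 = prim F s" if "s \<in> {-a<..<a}" for s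
  proof -
    have s: "-a < s * \<sigma>" "s * \<sigma> < a" if "\<sigma> \<in> {0..1}" for \<sigma>
    proof -
      have "\<bar>s * \<sigma>\<bar> \<le> \<bar>s\<bar> * 1"
        unfolding abs_mult using that by (intro mult_left_mono) auto
      then show "-a < s * \<sigma>" "s * \<sigma> < a"
        using \<open>s \<in> _\<close> by auto
    qed
    have "((\<lambda>\<sigma>. s *\<^sub>R F (s * \<sigma>)) has_integral (P (s * 1) - P (s * 0))) {0..1}"
    proof (rule fundamental_theorem_of_calculus)
      fix \<sigma> :: real assume \<sigma>: "\<sigma> \<in> {0..1}"
      have "((\<lambda>\<sigma>. s * \<sigma>) has_vector_derivative s) (at \<sigma>)"
        by (auto intro!: derivative_eq_intros)
      from vector_diff_chain_at[OF this P[OF s[OF \<sigma>]]]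
      show "((\<lambda>\<sigma>. P (s * \<sigma>)) has_vector_derivative s *\<^sub>R F (s * \<sigma>)) (at \<sigma> within {0..1})"
        by (auto simp: o_def intro: has_vector_derivative_at_within)
    qed simp
    then show ?thesis
      unfolding prim_def by (subst integral_unique) auto
  qed
  have "((\<lambda>s. P s - P 0) has_vector_derivative F t) (at t)"
    using has_vector_derivative_diff[OF P[of t] has_vector_derivative_const[of "P 0"]]
    by (simp add: a_def)
  moreover have "t \<in> {-a<..<a}"
    by (auto simp: a_def)
  ultimately show ?thesis
    using has_vector_derivative_transform_within_open[OF _ open_greaterThanLessThan] eq by blast
qed

lemma integral_eq_primitive_diff:
  fixes P :: "real \<Rightarrow> 'b::banach"
  assumes "\<And>t. (P has_vector_derivative F t) (at t)" "a \<le> b"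
  shows "integral {a..b} F = P b - P a"
  by (rule integral_unique, rule fundamental_theorem_of_calculus[OF assms(2)])
    (rule has_vector_derivative_at_within[OF assms(1)])

lemma prim_eq_integral:
  fixes F :: "real \<Rightarrow> 'b::banach"
  assumes "continuous_on UNIV F" "0 \<le> t"
  shows "prim F t = integral {0..t} F"
  using integral_eq_primitive_diff[OF prim_has_vector_derivative[OF assms(1)] assms(2)] by simp

lemma vector_derivative_eq_imp_diff_const:
  fixes f g :: "real \<Rightarrow> 'b::real_normed_vector"
  assumes "\<And>t. (f has_vector_derivative h t) (at t)" "\<And>t. (g has_vector_derivative h t) (at t)"
  shows "f t - g t = f 0 - g 0"
proof -
  have "((\<lambda>t. f t - g t) has_vector_derivative 0) (at t within UNIV)" for t
    using has_vector_derivative_diff[OF assms(1)[of t] assms(2)[of t]] by simp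
  then obtain c where "\<And>t. f t - g t = c"
    using has_vector_derivative_zero_constant[of UNIV "\<lambda>t. f t - g t"] by auto
  then show ?thesis by metis
qed

lemma has_vector_derivative_shift:
  assumes "(f has_vector_derivative d) (at (t + r))"
  shows "((\<lambda>s. f (s + r)) has_vector_derivative d) (at t)"
proof -
  have "((\<lambda>s. s + r) has_vector_derivative 1) (at t)"
    by (auto intro!: derivative_eq_intros)
  from vector_diff_chain_at[OF this assms] show ?thesis by (simp add: o_def)
qed

text \<open>The increment of a primitive over one period has derivative
  \<open>\<phi> (r + T) - \<phi> r = 0\<close> in \<open>r\<close>, so it does not depend on
  \<open>r\<close>.\<close>

lemma integral_periodic_shift:
  fixes \<phi> :: "real \<Rightarrow> 'b::banach"
  assumes "continuous_on UNIV \<phi>" "\<And>t. \<phi> (t + T) = \<phi> t" "0 \<le> T"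
  shows "integral {0..T} (\<lambda>t. \<phi> (t + r)) = integral {0..T} \<phi>"
proof -
  note P = prim_has_vector_derivative[OF assms(1)]
  have "integral {0..T} (\<lambda>t. \<phi> (t + r)) = prim \<phi> (T + r) - prim \<phi> (0 + r)"
    by (rule integral_eq_primitive_diff[OF has_vector_derivative_shift[OF P] assms(3)])
  moreover have "prim \<phi> (r + T) - prim \<phi> r = prim \<phi> (0 + T) - prim \<phi> 0"
    by (rule vector_derivative_eq_imp_diff_const[OF _ P])
      (use has_vector_derivative_shift[OF P] assms(2) in metis)
  ultimately show ?thesis
    using integral_eq_primitive_diff[OF P assms(3)] by (simp add: add.commute)
qed

section \<open>Fourier coefficients and the Riemann-Lebesgue lemma\<close>

definition fourier_coeff :: "(real \<Rightarrow> complex) \<Rightarrow> int \<Rightarrow> complex"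
  where "fourier_coeff \<phi> j = integral {0..2*pi} (\<lambda>b. cis (- (of_int j * b)) * \<phi> b) / (2 * pi)"

lemma cis_has_vector_derivative:
  "((\<lambda>b. cis (a * b)) has_vector_derivative \<i> * a * cis (a * b)) (at b within S)"
proof -
  have "((\<lambda>b. exp (b *\<^sub>R (\<i> * a))) has_vector_derivative exp (b *\<^sub>R (\<i> * a)) * (\<i> * a)) (at b within S)"
    by (rule exp_scaleR_has_vector_derivative_right)
  then show ?thesis
    by (simp add: cis_conv_exp scaleR_conv_of_real mult_ac)
qed

lemma continuous_on_cis_compose [continuous_intros]:
  "continuous_on S f \<Longrightarrow> continuous_on S (\<lambda>b. cis (f b))" for f :: "_ \<Rightarrow> real"
  unfolding cis_conv_exp by (intro continuous_intros)

lemma cis_int_period: "cis (of_int j * (b + 2 * pi)) = cis (of_int j * b)"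
proof -
  have "cis (of_int j * (b + 2 * pi)) = cis (of_int j * b) * cis (2 * pi * of_int j)"
    by (simp add: cis_mult algebra_simps)
  also have "cis (2 * pi * of_int j) = 1"
    by (intro cis_multiple_2pi) auto
  finally show ?thesis by simp
qed

lemma cis_int_2pi [simp]: "cis (of_int j * (2 * pi)) = 1" "cis (- (of_int j * (2 * pi))) = 1"
  using cis_int_period[of j 0] cis_int_period[of "-j" 0] by auto

lemma fourier_coeff_integrable:
  "continuous_on UNIV \<phi> \<Longrightarrow> (\<lambda>b. cis (- (of_int j * b)) * \<phi> b) integrable_on {0..2*pi}"
  by (intro integrable_continuous_real continuous_intros) (auto intro: continuous_on_subset)

lemma fourier_coeff_diff:
  assumes "continuous_on UNIV \<phi>" "continuous_on UNIV \<psi>"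
  shows "fourier_coeff (\<lambda>b. \<phi> b - \<psi> b) j = fourier_coeff \<phi> j - fourier_coeff \<psi> j"
  unfolding fourier_coeff_def right_diff_distrib
  by (subst integral_diff) (auto intro: fourier_coeff_integrable assms simp: diff_divide_distrib)

lemma fourier_coeff_cmult: "fourier_coeff (\<lambda>b. c * \<phi> b) j = c * fourier_coeff \<phi> j"
  by (simp add: fourier_coeff_def mult.left_commute[of "cis _" c])

text \<open>This turns the coefficients of \<open>(cis b - 1) * F b\<close> into differences of
  neighbouring coefficients of \<open>F\<close>, ready to telescope.\<close>

lemma fourier_coeff_cis_mult:
  "fourier_coeff (\<lambda>b. cis b * \<phi> b) j = fourier_coeff \<phi> (j - 1)"
proof -
  have "cis (- (of_int j * b)) * (cis b * \<phi> b) = cis (- (of_int (j - 1) * b)) * \<phi> b" for b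
    unfolding mult.assoc[symmetric] cis_mult by (simp add: algebra_simps)
  then show ?thesis by (simp only: fourier_coeff_def)
qed

lemma fourier_coeff_shift:
  assumes "continuous_on UNIV \<phi>" "\<And>b. \<phi> (b + 2 * pi) = \<phi> b"
  shows "fourier_coeff (\<lambda>b. \<phi> (b + r)) j = cis (of_int j * r) * fourier_coeff \<phi> j"
proof -
  define \<psi> where "\<psi> b = cis (- (of_int j * b)) * \<phi> b" for b
  have "cis (- (of_int j * b)) * \<phi> (b + r) = cis (of_int j * r) * \<psi> (b + r)" for b
    unfolding \<psi>_def mult.assoc[symmetric] cis_mult by (simp add: algebra_simps)
  moreover have "integral {0..2*pi} (\<lambda>b. \<psi> (b + r)) = integral {0..2*pi} \<psi>"
  proof (rule integral_periodic_shift)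
    show "continuous_on UNIV \<psi>"
      unfolding \<psi>_def by (intro continuous_intros assms(1))
    show "\<psi> (t + 2 * pi) = \<psi> t" for t
      using cis_int_period[of "-j" t] by (simp add: \<psi>_def assms(2))
  qed simp
  ultimately show ?thesis
    by (simp add: fourier_coeff_def \<psi>_def[symmetric])
qed

text \<open>Integration by parts; the boundary terms cancel by periodicity.\<close>

lemma fourier_coeff_derivative:
  assumes D: "\<And>b. (\<phi> has_vector_derivative \<phi>' b) (at b)"
    and "continuous_on UNIV \<phi>'" "\<And>b. \<phi> (b + 2 * pi) = \<phi> b"
  shows "fourier_coeff \<phi>' j = \<i> * of_int j * fourier_coeff \<phi> j"
proof -
  define e where "e b = cis (- (of_int j * b))" for b
  have e: "(e has_vector_derivative - (\<i> * of_int j) * e b) (at b)" for b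
    using cis_has_vector_derivative[of "- of_int j" b UNIV] by (simp add: e_def[abs_def])
  have \<phi>: "continuous_on UNIV \<phi>"
    using D by (auto intro!: continuous_at_imp_continuous_on has_vector_derivative_continuous)
  have i: "(\<lambda>b. e b * \<phi> b) integrable_on {0..2*pi}" "(\<lambda>b. e b * \<phi>' b) integrable_on {0..2*pi}"
    unfolding e_def by (intro fourier_coeff_integrable \<phi> assms(2))+
  have "integral {0..2*pi} (\<lambda>b. e b * \<phi>' b + (- (\<i> * of_int j) * e b) * \<phi> b)
      = e (2 * pi) * \<phi> (2 * pi) - e 0 * \<phi> 0"
    by (rule integral_eq_primitive_diff[OF has_vector_derivative_mult[OF e D]]) simp
  also have "\<dots> = 0"
    using assms(3)[of 0] by (simp add: e_def)
  also have "integral {0..2*pi} (\<lambda>b. e b * \<phi>' b + (- (\<i> * of_int j) * e b) * \<phi> b)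
      = integral {0..2*pi} (\<lambda>b. e b * \<phi>' b) - \<i> * of_int j * integral {0..2*pi} (\<lambda>b. e b * \<phi> b)"
    using i by (simp add: integral_diff integrable_on_mult_right mult.assoc)
  finally show ?thesis
    by (simp add: fourier_coeff_def e_def)
qed

lemma norm_fourier_coeff_le:
  assumes "continuous_on UNIV \<phi>" "\<And>b. b \<in> {0..2*pi} \<Longrightarrow> cmod (\<phi> b) \<le> B"
  shows "cmod (fourier_coeff \<phi> j) \<le> B"
proof -
  have "cmod (integral {0..2*pi} (\<lambda>b. cis (- (of_int j * b)) * \<phi> b)) \<le> B * (2 * pi - 0)"
    by (rule integral_bound)
      (auto simp: norm_mult intro!: assms continuous_intros continuous_on_subset[OF assms(1)])
  then show ?thesis
    by (simp add: fourier_coeff_def norm_divide field_simps)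
qed

text \<open>A shift by \<open>pi / j\<close> changes the sign of the coefficient of index
  \<open>j\<close>. Hence twice this coefficient belongs to the difference of \<open>F\<close> and
  its shift, which is uniformly small by uniform continuity.\<close>

lemma fourier_coeff_tendsto_0:
  assumes "continuous_on UNIV F" "\<And>b. F (b + 2 * pi) = F b" "0 < \<epsilon>"
  obtains N where "\<And>j. \<bar>j\<bar> \<ge> N \<Longrightarrow> cmod (fourier_coeff F j) < \<epsilon>"
proof -
  \<comment> \<open>The interval contains all translates of points of \<open>{0..2*pi}\<close> by at
    most \<open>pi\<close>.\<close>
  have "uniformly_continuous_on {-pi..3*pi} F"
    by (intro compact_uniformly_continuous continuous_on_subset[OF assms(1)]) auto
  then obtain d where d: "d > 0"
    "\<And>x y. x \<in> {-pi..3*pi} \<Longrightarrow> y \<in> {-pi..3*pi} \<Longrightarrow> dist y x < d \<Longrightarrow> dist (F y) (F x) < \<epsilon>"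
    using \<open>0 < \<epsilon>\<close> unfolding uniformly_continuous_on_def by metis
  \<comment> \<open>From \<open>N\<close> on the shift \<open>pi / j\<close> is shorter than
    \<open>d\<close>; the 1 keeps \<open>j\<close> nonzero and the shift at most
    \<open>pi\<close>.\<close>
  define N where "N = max 1 (\<lceil>pi / d\<rceil> + 1)"
  show ?thesis
  proof
    fix j :: int assume j: "\<bar>j\<bar> \<ge> N"
    then have j1: "\<bar>j\<bar> \<ge> 1" and "\<bar>j\<bar> \<ge> \<lceil>pi / d\<rceil> + 1"
      by (auto simp: N_def)
    then have "pi / d < \<bar>of_int j\<bar>"
      by linarith
    then have jd: "pi / \<bar>of_int j\<bar> < d"
      using d(1) j1 by (simp add: field_simps)
    define h where "h = pi / of_int j"
    have h: "\<bar>h\<bar> < d" "\<bar>h\<bar> \<le> pi" "of_int j * h = pi"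
      using jd j1 by (auto simp: h_def field_simps)
    have F': "continuous_on UNIV (\<lambda>b. F (b + h))"
      by (intro continuous_on_compose2[OF assms(1)] continuous_intros) auto
    have "fourier_coeff (\<lambda>b. F b - F (b + h)) j = 2 * fourier_coeff F j"
      using h by (simp add: fourier_coeff_diff[OF assms(1) F'] fourier_coeff_shift[OF assms(1,2)])
    moreover have "cmod (fourier_coeff (\<lambda>b. F b - F (b + h)) j) \<le> \<epsilon>"
    proof (rule norm_fourier_coeff_le)
      fix b assume "b \<in> {0..2*pi}"
      then have "dist (F b) (F (b + h)) < \<epsilon>"
        using h by (intro d(2)) (auto simp: dist_norm)
      then show "cmod (F b - F (b + h)) \<le> \<epsilon>"
        by (simp add: dist_norm)
    qed (intro continuous_intros assms(1) F')
    ultimately show "cmod (fourier_coeff F j) < \<epsilon>"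
      using \<open>0 < \<epsilon>\<close> by (simp add: norm_mult)
  qed
qed

section \<open>Pointwise convergence of symmetric Fourier sums\<close>

definition sym_term :: "(int \<Rightarrow> complex) \<Rightarrow> nat \<Rightarrow> complex"
  where "sym_term a i = (if i = 0 then a 0 else a (int i) + a (- int i))"

text \<open>The pairing of \<open>j\<close> with \<open>- j\<close> makes this the sum over all
  indices from \<open>- n\<close> to \<open>n\<close>, where only the two ends survive.\<close>

lemma sum_sym_term_telescope:
  "(\<Sum>i\<le>n. sym_term (\<lambda>j. a (j - 1) - a j) i) = a (- int n - 1) - a (int n)"
proof (induction n)
  case (Suc n)
  then show ?case
    by (simp add: sym_term_def minus_diff_commute[of "int n" 1])
qed (simp add: sym_term_def)

lemma sum_sym_term_add:
  "(\<Sum>i\<le>n. sym_term (\<lambda>j. a j + b j) i) = (\<Sum>i\<le>n. sym_term a i) + (\<Sum>i\<le>n. sym_term b i)"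
  unfolding sum.distrib[symmetric] by (intro sum.cong) (auto simp: sym_term_def)

lemma fourier_coeff_const: "fourier_coeff (\<lambda>b. c) j = (if j = 0 then c else 0)"
proof (cases "j = 0")
  case False
  have "fourier_coeff (\<lambda>b. 0) j = \<i> * of_int j * fourier_coeff (\<lambda>b. c) j"
    by (rule fourier_coeff_derivative) auto
  then show ?thesis
    using False by (simp add: fourier_coeff_def)
qed (simp add: fourier_coeff_def scaleR_conv_of_real)

lemma cis_eq_1D:
  assumes "cis b = 1"
  obtains k :: int where "b = 2 * pi * of_int k"
  using assms by (auto simp: complex_eq_iff cos_one_2pi_int mult_ac)

text \<open>Chernoff's argument: \<open>H b - H 0 = (cis b - 1) * F b\<close> with \<open>F\<close> continuous, so the symmetric
  partial sums telescope and the Riemann--Lebesgue lemma finishes.\<close>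

theorem fourier_series_at_0:
  assumes cont: "continuous_on UNIV H" and per: "\<And>b. H (b + 2 * pi) = H b"
    and D: "(H has_vector_derivative d) (at 0)"
  shows "(\<lambda>n. \<Sum>i\<le>n. sym_term (fourier_coeff H) i) \<longlonglongrightarrow> H 0"
proof -
  \<comment> \<open>At the zeros of \<open>cis b - 1\<close> the quotient is given its limit d / i,
    since \<open>cis\<close> has derivative i at 0.\<close>
  define F where "F b = (if cis b = 1 then - \<i> * d else (H b - H 0) / (cis b - 1))" for b
  have Fper: "F (b + 2 * pi) = F b" for b
    using cis_int_period[of 1 b] by (simp add: F_def per)
  have per_n: "f (x + 2 * pi * real n) = f x" if "\<And>b. f (b + 2 * pi) = f b"
    for f :: "real \<Rightarrow> complex" and x n
  proof (induction n)
    case (Suc n)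
    have "f (x + 2 * pi * real (Suc n)) = f ((x + 2 * pi * real n) + 2 * pi)"
      by (simp add: algebra_simps)
    then show ?case using that Suc by metis
  qed auto
  have per_int: "f (x + 2 * pi * of_int k) = f x" if p: "\<And>b. f (b + 2 * pi) = f b"
    for f :: "real \<Rightarrow> complex" and x k
  proof (cases "k \<ge> 0")
    case True
    then show ?thesis using per_n[of f x "nat k", OF p] by simp
  next
    case False
    then show ?thesis using per_n[of f "x + 2 * pi * of_int k" "nat (- k)", OF p] by simp
  qed
  have H0: "H b = H 0" if b: "cis b = 1" for b
  proof -
    obtain k where "b = 2 * pi * of_int k"
      using b by (rule cis_eq_1D)
    then show ?thesis using per_int[of H 0 k, OF per] by simp
  qed
  have HF: "H b = H 0 + (cis b - 1) * F b" for b
    using H0[of b] by (cases "cis b = 1") (simp_all add: F_def)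
  have F0: "isCont F 0"
  proof -
    have cisD: "(cis has_vector_derivative \<i>) (at 0)"
      using cis_has_vector_derivative[of 1 0 UNIV] by simp
    have q: "((\<lambda>b. (f b - f 0) /\<^sub>R b) \<longlongrightarrow> f') (at 0)"
      if "(f has_vector_derivative f') (at 0)" for f :: "real \<Rightarrow> complex" and f'
    proof -
      have "((\<lambda>b. norm ((f b - f 0) /\<^sub>R b - f')) \<longlongrightarrow> 0) (at 0)"
      proof (rule Lim_transform_eventually)
        show "((\<lambda>b. norm (f b - f 0 - b *\<^sub>R f') / norm b) \<longlongrightarrow> 0) (at 0)"
          using that by (simp add: has_vector_derivative_def has_derivative_at)
        show "\<forall>\<^sub>F b in at 0. norm (f b - f 0 - b *\<^sub>R f') / norm b = norm ((f b - f 0) /\<^sub>R b - f')"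
        proof (rule eventually_at_topological[THEN iffD2], intro exI[of _ UNIV] conjI ballI impI)
          fix b :: real assume "b \<noteq> 0"
          then have "(f b - f 0) /\<^sub>R b - f' = (f b - f 0 - b *\<^sub>R f') /\<^sub>R b"
            by (simp add: scaleR_diff_right)
          then show "norm (f b - f 0 - b *\<^sub>R f') / norm b = norm ((f b - f 0) /\<^sub>R b - f')"
            by (simp add: divide_inverse)
        qed auto
      qed
      then show ?thesis
        by (subst Lim_null) (rule tendsto_norm_zero_cancel)
    qed
    \<comment> \<open>Both increments are divided by \<open>b\<close>, so the limit is a quotient of
      two derivatives.\<close>
    have "((\<lambda>b. ((H b - H 0) /\<^sub>R b) / ((cis b - cis 0) /\<^sub>R b)) \<longlongrightarrow> d / \<i>) (at 0)"
      by (intro tendsto_divide q D cisD) simp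
    moreover have "\<forall>\<^sub>F b in at 0. ((H b - H 0) /\<^sub>R b) / ((cis b - cis 0) /\<^sub>R b) = F b"
    proof -
      have "cis b \<noteq> 1" if "b \<noteq> 0" "\<bar>b\<bar> < 2 * pi" for b
      proof
        assume "cis b = 1"
        then obtain k where k: "b = 2 * pi * of_int k"
          by (rule cis_eq_1D)
        then have "k \<noteq> 0" "\<bar>of_int k :: real\<bar> < 1"
          using that by (auto simp: abs_mult)
        then show False by linarith
      qed
      then have "((H b - H 0) /\<^sub>R b) / ((cis b - cis 0) /\<^sub>R b) = F b" if "b \<noteq> 0" "dist b 0 < 2 * pi" for b
        using that by (simp add: F_def scaleR_conv_of_real)
      then show ?thesis
        unfolding eventually_at by (intro exI[of _ "2 * pi"]) auto
    qed
    moreover have "d / \<i> = F 0"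
      by (simp add: F_def field_simps)
    ultimately show ?thesis
      unfolding isCont_def using tendsto_cong by force
  qed
  have Fcont: "continuous_on UNIV F"
  proof (intro continuous_at_imp_continuous_on ballI)
    fix b
    show "isCont F b"
    proof (cases "cis b = 1")
      \<comment> \<open>Every zero of \<open>cis b - 1\<close> is a translate of 0 by a period of
        \<open>F\<close>, so continuity at 0 carries over.\<close>
      case True
      then obtain k where k: "b = 2 * pi * of_int k"
        by (rule cis_eq_1D)
      have "isCont (\<lambda>x. F (x - b)) b"
        by (rule isCont_o2[where g = F]) (auto intro!: continuous_intros F0)
      moreover have "F (x - b) = F x" for x
        using per_int[of F "x - b" k, OF Fper] by (simp add: k)
      ultimately show ?thesis by simp
    next
      case False
      have "open {x. cis x \<noteq> 1}"
        by (intro open_Collect_neq continuous_intros)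
      moreover have "continuous_on {x. cis x \<noteq> 1} F"
      proof (rule continuous_on_eq)
        show "continuous_on {x. cis x \<noteq> 1} (\<lambda>x. (H x - H 0) / (cis x - 1))"
          by (intro continuous_intros continuous_on_subset[OF cont]) auto
      qed (auto simp: F_def)
      ultimately show ?thesis
        using False by (simp add: continuous_on_eq_continuous_at)
    qed
  qed
  have coeff: "fourier_coeff H j = (if j = 0 then H 0 else 0) + (fourier_coeff F (j - 1) - fourier_coeff F j)" for j
  proof -
    have "fourier_coeff H j = fourier_coeff (\<lambda>b. H 0 - (F b - cis b * F b)) j"
      using HF by (intro arg_cong[of _ _ "\<lambda>f. fourier_coeff f j"]) (auto simp: algebra_simps)
    also have "\<dots> = fourier_coeff (\<lambda>b. H 0) j - (fourier_coeff F j - fourier_coeff (\<lambda>b. cis b * F b) j)"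
      by (subst fourier_coeff_diff fourier_coeff_diff, intro continuous_intros Fcont,
          intro continuous_intros Fcont)+ simp
    finally show ?thesis
      by (simp add: fourier_coeff_const fourier_coeff_cis_mult)
  qed
  have "(\<Sum>i\<le>n. sym_term (\<lambda>j. if j = 0 then H 0 else 0) i) = H 0" for n
    by (induction n) (auto simp: sym_term_def)
  \<comment> \<open>The constant contributes \<open>H 0\<close>; the rest telescopes to two
    coefficients of \<open>F\<close>, which vanish in the limit.\<close>
  then have S: "(\<Sum>i\<le>n. sym_term (fourier_coeff H) i)
      = H 0 + (fourier_coeff F (- int n - 1) - fourier_coeff F (int n))" for n
    unfolding coeff[abs_def] sum_sym_term_add sum_sym_term_telescope by simp
  have "(\<lambda>n. fourier_coeff F (- int n - 1)) \<longlonglongrightarrow> 0" "(\<lambda>n. fourier_coeff F (int n)) \<longlonglongrightarrow> 0"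
  proof -
    have *: "\<exists>N. \<forall>n\<ge>N. cmod (fourier_coeff F (- int n - 1)) < e \<and> cmod (fourier_coeff F (int n)) < e"
      if e: "e > 0" for e
    proof -
      obtain N where "\<And>j. \<bar>j\<bar> \<ge> N \<Longrightarrow> cmod (fourier_coeff F j) < e"
        using fourier_coeff_tendsto_0[OF Fcont Fper e] by blast
      then show ?thesis by (intro exI[of _ "nat N"]) auto
    qed
    show "(\<lambda>n. fourier_coeff F (- int n - 1)) \<longlonglongrightarrow> 0" "(\<lambda>n. fourier_coeff F (int n)) \<longlonglongrightarrow> 0"
      by (rule LIMSEQ_I; use * in fastforce)+
  qed
  from tendsto_add[OF tendsto_const[of "H 0"] tendsto_diff[OF this]]
  show ?thesis unfolding S by simp
qed

text \<open>Up to reflection \<open>K\<close> is the Fourier series with coefficients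
  \<open>\<kappa>\<close>. It converges uniformly by the Weierstrass test, as 1 / (1 + j^2) is
  summable, and can be integrated against \<open>\<phi>\<close> term by term. Identifying the limit
  \<open>L\<close> is left to the application.\<close>

lemma multiplier_kernel:
  assumes "\<And>j. cmod (\<kappa> j) \<le> B / (1 + (of_int j)\<^sup>2)"
  obtains K where "continuous_on {0..2*pi} K"
    "\<And>\<phi> L. continuous_on UNIV \<phi> \<Longrightarrow>
      (\<lambda>n. \<Sum>i\<le>n. sym_term (\<lambda>j. \<kappa> j * fourier_coeff \<phi> j) i) \<longlonglongrightarrow> L \<Longrightarrow>
      integral {0..2*pi} (\<lambda>b. K b * \<phi> b) = L"
proof -
  define a where "a i b = sym_term (\<lambda>j. \<kappa> j * cis (- (of_int j * b)) / (2 * pi)) i" for i b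
  define K where "K b = (\<Sum>i. a i b)" for b
  have cont_a: "continuous_on S (a i)" for S i
    by (cases "i = 0") (auto simp: a_def[abs_def] sym_term_def intro!: continuous_intros)
  have B: "B \<ge> 0" using order_trans[OF norm_ge_zero assms[of 0]] by simp
  have bound: "cmod (a i b) \<le> 2 * (B / (1 + (of_nat i)\<^sup>2))" for i b
  proof -
    have 1: "cmod (\<kappa> j * cis (- (of_int j * b)) / (2 * pi)) \<le> B / (1 + (of_int j)\<^sup>2)" for j
    proof -
      have "cmod (\<kappa> j * cis (- (of_int j * b)) / (2 * pi)) = cmod (\<kappa> j) / (2 * pi)"
        by (simp add: norm_mult norm_divide)
      also have "\<dots> \<le> cmod (\<kappa> j) / 1"
        using pi_gt3 by (intro divide_left_mono) auto
      finally show ?thesis using assms[of j] by simp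
    qed
    show ?thesis
    proof (cases "i = 0")
      case True
      then show ?thesis using 1[of 0] B by (simp add: a_def sym_term_def)
    next
      case False
      then show ?thesis
        using norm_triangle_mono[OF 1[of "int i"] 1[of "- int i"]] by (simp add: a_def sym_term_def)
    qed
  qed
  have summable: "summable (\<lambda>i. 2 * (B / (1 + (real i)\<^sup>2)))"
  proof -
    have "summable (\<lambda>i. 2 * B * inverse ((real i)\<^sup>2))"
      by (intro summable_mult inverse_power_summable) auto
    \<comment> \<open>The comparison starts at 1: \<open>inverse 0\<close> is 0 and in general does
      not dominate the term with \<open>i = 0\<close>.\<close>
    moreover have "norm (2 * (B / (1 + (real i)\<^sup>2))) \<le> 2 * B * inverse ((real i)\<^sup>2)" if "i \<ge> 1" for i
    proof -
      have "B * (real i)\<^sup>2 \<le> B * (1 + (real i)\<^sup>2)"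
        using B by (intro mult_left_mono) auto
      then show ?thesis
        using that B by (simp add: field_simps add_pos_nonneg)
    qed
    ultimately show ?thesis
      by (rule summable_comparison_test'[where N = 1])
  qed
  have unif: "uniform_limit {0..2*pi} (\<lambda>n b. \<Sum>i<n. a i b) K sequentially"
    unfolding K_def by (rule Weierstrass_m_test[OF bound summable])
  have contK: "continuous_on {0..2*pi} K"
    by (rule uniform_limit_theorem[OF _ unif]) (auto intro!: continuous_intros cont_a always_eventually)
  show ?thesis
  proof
    fix \<phi> L assume \<phi>: "continuous_on UNIV \<phi>"
      and L: "(\<lambda>n. \<Sum>i\<le>n. sym_term (\<lambda>j. \<kappa> j * fourier_coeff \<phi> j) i) \<longlonglongrightarrow> L"
    have \<phi>': "continuous_on {0..2*pi} \<phi>"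
      by (rule continuous_on_subset[OF \<phi>]) simp
    have "bounded (\<phi> ` {0..2*pi})" "bounded (K ` {0..2*pi})"
      by (auto intro!: compact_imp_bounded compact_continuous_image \<phi>' contK)
    then have "uniform_limit {0..2*pi} (\<lambda>n b. (\<Sum>i<n. a i b) * \<phi> b) (\<lambda>b. K b * \<phi> b) sequentially"
      by (intro uniform_lim_mult unif uniform_limit_const) auto
    then obtain I J where I: "\<And>n. ((\<lambda>b. (\<Sum>i<n. a i b) * \<phi> b) has_integral I n) {0..2*pi}"
      and J: "((\<lambda>b. K b * \<phi> b) has_integral J) {0..2*pi}" "I \<longlonglongrightarrow> J"
      by (rule uniform_limit_integral) (auto intro!: continuous_intros cont_a \<phi>')
    have ai: "((\<lambda>b. a i b * \<phi> b) has_integral sym_term (\<lambda>j. \<kappa> j * fourier_coeff \<phi> j) i) {0..2*pi}" for i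
    proof -
      have "((\<lambda>b. \<kappa> j / (2 * pi) * (cis (- (of_int j * b)) * \<phi> b)) has_integral
          \<kappa> j / (2 * pi) * integral {0..2*pi} (\<lambda>b. cis (- (of_int j * b)) * \<phi> b)) {0..2*pi}" for j
        by (intro has_integral_mult_right integrable_integral fourier_coeff_integrable \<phi>)
      then have *: "((\<lambda>b. \<kappa> j * cis (- (of_int j * b)) / (2 * pi) * \<phi> b) has_integral
          \<kappa> j * fourier_coeff \<phi> j) {0..2*pi}" for j
        by (simp add: fourier_coeff_def mult_ac)
      show ?thesis
        using *[of 0] has_integral_add[OF *[of "int i"] *[of "- int i"]]
        by (auto simp: a_def sym_term_def distrib_right)
    qed
    have "I n = (\<Sum>i<n. sym_term (\<lambda>j. \<kappa> j * fourier_coeff \<phi> j) i)" for n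
    proof -
      have "((\<lambda>b. \<Sum>i<n. a i b * \<phi> b) has_integral
          (\<Sum>i<n. sym_term (\<lambda>j. \<kappa> j * fourier_coeff \<phi> j) i)) {0..2*pi}"
        by (intro has_integral_sum ai) auto
      then show ?thesis
        using has_integral_unique[OF I[of n]] by (simp add: sum_distrib_right)
    qed
    \<comment> \<open>\<open>I n\<close> sums over \<open>i < n\<close> but the assumption over
      \<open>i \<le> n\<close>, hence the shift by one.\<close>
    then have "(\<lambda>n. I (Suc n)) \<longlonglongrightarrow> L"
      using L by (simp add: lessThan_Suc_atMost)
    then have "J = L"
      using LIMSEQ_unique[OF LIMSEQ_Suc[OF J(2)]] by blast
    then show "integral {0..2*pi} (\<lambda>b. K b * \<phi> b) = L"
      using J(1) by (simp add: integral_unique)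
  qed (rule contK)
qed

section \<open>Transport along a circle action\<close>

text \<open>\<open>J\<close> is a complex structure, so \<open>cos \<theta>\<close> plus
  \<open>sin \<theta>\<close> times \<open>J\<close> is the exponential of \<theta> J: a linear flow
  of period 2 pi that leaves \<open>S\<close> invariant.\<close>

locale circle_action =
  fixes J :: "'a::euclidean_space \<Rightarrow> 'a" and S :: "'a set"
  assumes bounded_linear_J: "bounded_linear J" and J_J: "J (J x) = - x"
    and open_S: "open S"
    and invariant: "x \<in> S \<Longrightarrow> cos \<theta> *\<^sub>R x + sin \<theta> *\<^sub>R J x \<in> S"
begin

lemmas linear_J = bounded_linear.linear[OF bounded_linear_J]

definition rot :: "real \<Rightarrow> 'a \<Rightarrow> 'a"
  where "rot \<theta> x = cos \<theta> *\<^sub>R x + sin \<theta> *\<^sub>R J x"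

lemma rot_in_S: "x \<in> S \<Longrightarrow> rot \<theta> x \<in> S"
  unfolding rot_def by (rule invariant)

lemma rot_0 [simp]: "rot 0 x = x"
  by (simp add: rot_def)

lemma rot_period: "rot (\<theta> + 2 * pi) x = rot \<theta> x"
  by (simp add: rot_def)

lemma rot_rot: "rot a (rot b x) = rot (a + b) x"
  by (simp add: rot_def cos_add sin_add linear_add[OF linear_J] linear_scale[OF linear_J] J_J
      algebra_simps)

lemma rot_has_vector_derivative: "((\<lambda>\<theta>. rot \<theta> x) has_vector_derivative J (rot \<theta> x)) (at \<theta>)"
  unfolding rot_def
  by (auto intro!: derivative_eq_intros
      simp: linear_add[OF linear_J] linear_scale[OF linear_J] J_J algebra_simps)

lemma Cinf_on_rot:
  assumes "open T" "Cinf_on T a" "Cinf_on T g"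
  shows "Cinf_on T (\<lambda>z. rot (a z) (g z))"
  unfolding rot_def
  by (intro Cinf_on_add Cinf_on_scaleR assms Cinf_on_bounded_linear[OF assms(1) bounded_linear_J]
      Cinf_on_compose[OF Cinf_on_sin assms(1) open_UNIV] Cinf_on_compose[OF Cinf_on_cos assms(1) open_UNIV]) auto

section \<open>Derivatives and Fourier coefficients along the orbits\<close>

definition X :: "('a \<Rightarrow> complex) \<Rightarrow> 'a \<Rightarrow> complex"
  where "X G x = frechet_derivative G (at x) (J x)"

lemma Cinf_on_X: "Cinf_on S G \<Longrightarrow> Cinf_on S (X G)"
  unfolding X_def[abs_def]
  by (rule Cinf_on_frechet_apply[OF open_S _ Cinf_on_linear[OF open_S bounded_linear_J]])

lemma X_orbit:
  assumes "Cinf_on S G" "x \<in> S"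
  shows "((\<lambda>b. G (rot b x)) has_vector_derivative X G (rot b x)) (at b)"
proof -
  have "((\<lambda>b. G (rot b x)) has_derivative
      (\<lambda>h. frechet_derivative G (at (rot b x)) (h *\<^sub>R J (rot b x)))) (at b)"
    by (rule has_derivative_compose[OF rot_has_vector_derivative[unfolded has_vector_derivative_def]
          Cinf_on_has_derivative[OF assms(1) rot_in_S[OF assms(2)]]])
  moreover have "linear (frechet_derivative G (at (rot b x)))"
    using Cinf_on_has_derivative[OF assms(1) rot_in_S[OF assms(2)]] by (rule has_derivative_linear)
  ultimately show ?thesis
    by (simp add: has_vector_derivative_def X_def linear_scale)
qed

lemma continuous_on_orbit:
  fixes G :: "'a \<Rightarrow> complex"
  assumes "Cinf_on S G" "x \<in> S"
  shows "continuous_on UNIV (\<lambda>b. G (rot b x))"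
  using X_orbit[OF assms]
  by (auto intro!: continuous_at_imp_continuous_on has_vector_derivative_continuous)

text \<open>This operator multiplies the coefficient of index j along an orbit by 1 + j^2. Unlike
  the factor i j of \<open>X\<close>, this one never vanishes, so it can be divided out
  again.\<close>

definition E :: "('a \<Rightarrow> complex) \<Rightarrow> 'a \<Rightarrow> complex"
  where "E G x = G x - X (X G) x"

lemma Cinf_on_E: "Cinf_on S G \<Longrightarrow> Cinf_on S (E G)"
  unfolding E_def[abs_def] by (intro Cinf_on_diff open_S Cinf_on_X)

lemma Cinf_on_E_power: "Cinf_on S G \<Longrightarrow> Cinf_on S ((E ^^ n) G)"
  by (induction n) (auto intro: Cinf_on_E)

lemma fourier_coeff_X:
  assumes "Cinf_on S G" "x \<in> S"
  shows "fourier_coeff (\<lambda>b. X G (rot b x)) j = \<i> * of_int j * fourier_coeff (\<lambda>b. G (rot b x)) j"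
  by (rule fourier_coeff_derivative)
    (use assms in \<open>auto intro: X_orbit continuous_on_orbit Cinf_on_X simp: rot_period\<close>)

lemma fourier_coeff_E_power:
  assumes "Cinf_on S G" "x \<in> S"
  shows "fourier_coeff (\<lambda>b. (E ^^ n) G (rot b x)) j
    = (1 + (of_int j)\<^sup>2) ^ n * fourier_coeff (\<lambda>b. G (rot b x)) j"
proof (induction n)
  case (Suc n)
  let ?G = "(E ^^ n) G"
  have G: "Cinf_on S ?G"
    by (rule Cinf_on_E_power[OF assms(1)])
  have "fourier_coeff (\<lambda>b. (E ^^ Suc n) G (rot b x)) j
      = fourier_coeff (\<lambda>b. ?G (rot b x)) j - fourier_coeff (\<lambda>b. X (X ?G) (rot b x)) j"
    by (simp add: E_def fourier_coeff_diff continuous_on_orbit G Cinf_on_X assms)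
  also have "fourier_coeff (\<lambda>b. X (X ?G) (rot b x)) j = - (of_int j)\<^sup>2 * fourier_coeff (\<lambda>b. ?G (rot b x)) j"
  proof -
    have "fourier_coeff (\<lambda>b. X (X ?G) (rot b x)) j
        = (\<i> * \<i>) * (of_int j)\<^sup>2 * fourier_coeff (\<lambda>b. ?G (rot b x)) j"
      unfolding fourier_coeff_X[OF Cinf_on_X[OF G] assms(2)] fourier_coeff_X[OF G assms(2)]
      by (simp only: power2_eq_square mult_ac)
    then show ?thesis by simp
  qed
  finally show ?case
    by (simp add: Suc algebra_simps)
qed simp

text \<open>Dividing the Fourier coefficients along the orbits by \<open>cis (j * r) - \<lambda>\<close> is convolution with a
  continuous kernel, once sufficiently many derivatives have been moved onto \<open>G\<close>.\<close>

lemma cohomological_equation: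
  assumes G: "Cinf_on S G" and "0 < c"
    and small: "\<And>j. cmod (cis (of_int j * r) - \<mu>) \<ge> c / (1 + (of_int j)\<^sup>2) ^ N"
  obtains v where "Cinf_on S v" "\<And>x. x \<in> S \<Longrightarrow> v (rot r x) - \<mu> * v x = G x"
proof -
  \<comment> \<open>\<open>N\<close> factors 1 + j^2 make up for the small divisor; the extra one
    gives \<open>\<kappa>\<close> the decay that \<open>multiplier_kernel\<close> asks for.\<close>
  define G' where "G' = (E ^^ Suc N) G"
  have G': "Cinf_on S G'"
    unfolding G'_def by (rule Cinf_on_E_power[OF G])
  have pos: "1 + (of_int j :: real)\<^sup>2 > 0" for j
    by (simp add: add_pos_nonneg)
  have ne: "cis (of_int j * r) - \<mu> \<noteq> 0" for j
  proof -
    have "c / (1 + (of_int j)\<^sup>2) ^ N > 0"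
      using \<open>0 < c\<close> pos[of j] by simp
    then show ?thesis using small[of j] by auto
  qed
  have ne': "(1 + (of_int j :: complex)\<^sup>2) \<noteq> 0" for j
  proof -
    have "(1 + (of_int j :: complex)\<^sup>2) = of_real (1 + (of_int j)\<^sup>2)"
      by simp
    then show ?thesis using pos[of j] by (metis less_irrefl of_real_eq_0_iff)
  qed
  define \<kappa> where "\<kappa> j = 1 / ((cis (of_int j * r) - \<mu>) * (1 + (of_int j)\<^sup>2) ^ Suc N)" for j
  have "cmod (\<kappa> j) \<le> (1 / c) / (1 + (of_int j)\<^sup>2)" for j
  proof -
    let ?w = "1 + (of_int j :: real)\<^sup>2"
    have "cmod (1 + (of_int j :: complex)\<^sup>2) = cmod (of_real ?w)"
      by simp
    also have "\<dots> = ?w"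
      using pos[of j] by (simp only: norm_of_real abs_of_pos)
    finally have w: "cmod (\<kappa> j) = 1 / (cmod (cis (of_int j * r) - \<mu>) * ?w ^ Suc N)"
      by (simp add: \<kappa>_def norm_divide norm_mult norm_power)
    have "c / ?w ^ N * ?w ^ Suc N \<le> cmod (cis (of_int j * r) - \<mu>) * ?w ^ Suc N"
      using pos[of j] by (intro mult_right_mono small) simp
    moreover have "c / ?w ^ N * ?w ^ Suc N = c * ?w"
      using pos[of j] by simp
    ultimately have "cmod (\<kappa> j) \<le> 1 / (c * ?w)"
      unfolding w using pos[of j] \<open>0 < c\<close> by (intro divide_left_mono mult_pos_pos) auto
    then show ?thesis by simp
  qed
  then obtain K where K: "continuous_on {0..2*pi} K"
    "\<And>\<phi> L. continuous_on UNIV \<phi> \<Longrightarrow>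
      (\<lambda>n. \<Sum>i\<le>n. sym_term (\<lambda>j. \<kappa> j * fourier_coeff \<phi> j) i) \<longlonglongrightarrow> L \<Longrightarrow>
      integral {0..2*pi} (\<lambda>b. K b * \<phi> b) = L"
    using multiplier_kernel[of \<kappa> "1 / c"] by blast
  define v where "v x = integral {0..2*pi} (\<lambda>b. K b * G' (rot b x))" for x
  have US: "open (UNIV \<times> S :: (real \<times> 'a) set)"
    by (simp add: open_Times open_S)
  have "Cinf_on (UNIV \<times> S) (\<lambda>z. G' (rot (fst z) (snd z)))"
    by (rule Cinf_on_compose[OF G' US open_S])
      (auto intro!: Cinf_on_rot Cinf_on_intros US rot_in_S)
  then have "Cinf_on S v"
    unfolding v_def[abs_def] using Cinf_on_integral_param[OF open_S K(1)] by fastforce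
  moreover have "v (rot r x) - \<mu> * v x = G x" if x: "x \<in> S" for x
  proof -
    let ?\<psi> = "\<lambda>b. G' (rot b x)"
    have c\<psi>: "continuous_on UNIV ?\<psi>"
      by (rule continuous_on_orbit[OF G' x])
    have c\<psi>r: "continuous_on UNIV (\<lambda>b. ?\<psi> (b + r))"
      by (intro continuous_on_compose2[OF c\<psi>] continuous_intros) auto
    have int: "(\<lambda>b. K b * f b) integrable_on {0..2*pi}" if "continuous_on UNIV f" for f
      by (intro integrable_continuous_real continuous_intros K(1) continuous_on_subset[OF that]) auto
    have "v (rot r x) - \<mu> * v x = integral {0..2*pi} (\<lambda>b. K b * ?\<psi> (b + r)) - \<mu> * integral {0..2*pi} (\<lambda>b. K b * ?\<psi> b)"
      by (simp add: v_def rot_rot)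
    also have "\<dots> = integral {0..2*pi} (\<lambda>b. K b * ?\<psi> (b + r) - \<mu> * (K b * ?\<psi> b))"
      by (simp add: integral_diff int[OF c\<psi>] int[OF c\<psi>r] integrable_on_mult_right)
    also have "\<dots> = integral {0..2*pi} (\<lambda>b. K b * (?\<psi> (b + r) - \<mu> * ?\<psi> b))"
      by (intro arg_cong[of _ _ "integral _"]) (auto simp: algebra_simps)
    also have "\<dots> = G x"
    proof (rule K(2))
      show c\<phi>: "continuous_on UNIV (\<lambda>b. ?\<psi> (b + r) - \<mu> * ?\<psi> b)"
        by (intro continuous_intros c\<psi> c\<psi>r)
      \<comment> \<open>The divisor and the powers of 1 + j^2 cancel, leaving the Fourier series of
        \<open>G\<close> along the orbit, summed at the parameter 0.\<close>
      have "\<kappa> j * fourier_coeff (\<lambda>b. ?\<psi> (b + r) - \<mu> * ?\<psi> b) j = fourier_coeff (\<lambda>b. G (rot b x)) j" for j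
      proof -
        have "fourier_coeff (\<lambda>b. ?\<psi> (b + r) - \<mu> * ?\<psi> b) j = (cis (of_int j * r) - \<mu>) * fourier_coeff ?\<psi> j"
          by (subst fourier_coeff_diff[OF c\<psi>r])
            (auto simp: fourier_coeff_cmult fourier_coeff_shift[OF c\<psi>] rot_period left_diff_distrib
              intro!: continuous_intros c\<psi>)
        also have "fourier_coeff ?\<psi> j = (1 + (of_int j)\<^sup>2) ^ Suc N * fourier_coeff (\<lambda>b. G (rot b x)) j"
          unfolding G'_def by (rule fourier_coeff_E_power[OF G x])
        finally show ?thesis
          unfolding \<kappa>_def using ne[of j] ne'[of j] by (simp del: power_Suc)
      qed
      then show "(\<lambda>n. \<Sum>i\<le>n. sym_term (\<lambda>j. \<kappa> j * fourier_coeff (\<lambda>b. ?\<psi> (b + r) - \<mu> * ?\<psi> b) j) i)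
        \<longlonglongrightarrow> G x"
        using fourier_series_at_0[OF continuous_on_orbit[OF G x] _ X_orbit[OF G x, of 0]]
        by (simp add: rot_period)
    qed
    finally show ?thesis .
  qed
  ultimately show ?thesis by (rule that)
qed

text \<open>Variation of constants along the flow \<open>(t + r, rot (- p r) x)\<close>; requiring the solution to be
  periodic in \<open>t\<close> is a cohomological equation for its values at \<open>t = 0\<close>.\<close>

lemma transport_equation:
  fixes c :: "real \<Rightarrow> complex"
  assumes c: "Cinf_on UNIV c" "\<And>t. c (t + 2 * pi) = c t"
    and h: "Cinf_on (UNIV \<times> S) h" "\<And>t x. x \<in> S \<Longrightarrow> h (t + 2 * pi, x) = h (t, x)"
    and "0 < d"
    and small: "\<And>j. cmod (cis (of_int j * (- (2 * pi * p))) - exp (integral {0..2*pi} c))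
      \<ge> d / (1 + (of_int j)\<^sup>2) ^ N"
  obtains y where "Cinf_on (UNIV \<times> S) y" "\<And>t x. x \<in> S \<Longrightarrow> y (t + 2 * pi, x) = y (t, x)"
    "\<And>t x. x \<in> S \<Longrightarrow>
      ((\<lambda>r. y (t + r, rot (- (p * r)) x)) has_vector_derivative c t * y (t, x) + h (t, x)) (at 0)"
proof -
  have US: "open (UNIV \<times> S :: (real \<times> 'a) set)" and UUS: "open (UNIV \<times> UNIV \<times> S :: (real \<times> real \<times> 'a) set)"
    by (auto simp: open_Times open_S)
  have cont_c: "continuous_on UNIV c"
    by (rule Cinf_on_imp_continuous_on[OF c(1)])
  define C where "C = prim c"
  have C: "(C has_vector_derivative c t) (at t)" for t
    unfolding C_def by (rule prim_has_vector_derivative[OF cont_c])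
  define \<mu> where "\<mu> = exp (C (2 * pi))"
  have \<mu>: "\<mu> = exp (integral {0..2*pi} c)" "\<mu> \<noteq> 0"
    by (simp_all add: \<mu>_def C_def prim_eq_integral[OF cont_c])
  have C_shift: "C (t + 2 * pi) = C t + C (2 * pi)" for t
  proof -
    have "C (t + 2 * pi) - C t = C (0 + 2 * pi) - C 0"
      by (rule vector_derivative_eq_imp_diff_const[OF _ C])
        (use has_vector_derivative_shift[OF C] c(2) in metis)
    then show ?thesis by (simp add: C_def algebra_simps)
  qed
  have expC: "Cinf_on UNIV (\<lambda>t. exp (C t))" "Cinf_on UNIV (\<lambda>t. exp (- C t))"
    by (intro Cinf_on_exp_primitive[OF C c(1)]
        Cinf_on_exp_primitive[OF has_vector_derivative_minus[OF C] Cinf_on_minus[OF open_UNIV c(1)]])+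
  \<comment> \<open>\<open>exp (- C \<tau>)\<close> is the integrating factor; \<open>h\<close> is
    read along the flow line that starts at \<open>x\<close>.\<close>
  define Q where "Q = (\<lambda>(\<tau>, x). exp (- C \<tau>) * h (\<tau>, rot (- (p * \<tau>)) x))"
  have Q: "Cinf_on (UNIV \<times> S) Q"
    unfolding Q_def split_beta
    by (intro Cinf_on_mult US Cinf_on_compose[OF expC(2) US open_UNIV] Cinf_on_compose[OF h(1) US US]
        Cinf_on_rot Cinf_on_intros) (auto intro!: rot_in_S)
  have cont_Q: "continuous_on UNIV (\<lambda>\<tau>. Q (\<tau>, x))" if "x \<in> S" for x
    by (rule continuous_on_compose2[OF Cinf_on_imp_continuous_on[OF Q]])
      (use that in \<open>auto intro!: continuous_intros\<close>)
  define I where "I = (\<lambda>(t, x). prim (\<lambda>\<tau>. Q (\<tau>, x)) t)"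
  have I: "Cinf_on (UNIV \<times> S) I"
  proof -
    \<comment> \<open>Over the unit interval the integrand is jointly smooth in the integration
      variable, \<open>t\<close> and \<open>x\<close>, so \<open>t\<close> can be treated as a
      parameter.\<close>
    have "Cinf_on (UNIV \<times> UNIV \<times> S)
        (\<lambda>w. fst (snd w) *\<^sub>R Q (fst (snd w) * fst w, snd (snd w)))"
      by (intro Cinf_on_scaleR UUS Cinf_on_compose[OF Q UUS US] Cinf_on_intros
          Cinf_on_bounded_linear[OF UUS bounded_linear_fst] Cinf_on_bounded_linear[OF UUS bounded_linear_snd]) auto
    from Cinf_on_integral_param[OF US continuous_on_const[of "{0..1}" 1] this]
    show ?thesis by (simp add: I_def prim_def case_prod_unfold)
  qed
  have dI: "((\<lambda>t. I (t, x)) has_vector_derivative Q (t, x)) (at t)" if "x \<in> S" for t x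
    unfolding I_def by (simp add: prim_has_vector_derivative[OF cont_Q[OF that]])
  have I0: "I (0, x) = 0" for x
    by (simp add: I_def)
  have I_shift: "\<mu> * I (t + 2 * pi, x) = I (t, rot (- (2 * pi * p)) x) + \<mu> * I (2 * pi, x)" if x: "x \<in> S" for t x
  proof -
    \<comment> \<open>After one period the flow line of \<open>x\<close> continues as that of the
      rotated point, while the integrating factor has gained 1 / \<mu>.\<close>
    have Qs: "\<mu> * Q (t + 2 * pi, x) = Q (t, rot (- (2 * pi * p)) x)" for t
    proof -
      have "exp (- C (t + 2 * pi)) = exp (- C t) / \<mu>"
        by (simp add: C_shift \<mu>_def exp_diff)
      then show ?thesis
        using \<mu>(2) h(2)[OF rot_in_S[OF x]] by (simp add: Q_def rot_rot algebra_simps)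
    qed
    have "\<mu> * I (t + 2 * pi, x) - I (t, rot (- (2 * pi * p)) x)
        = \<mu> * I (0 + 2 * pi, x) - I (0, rot (- (2 * pi * p)) x)"
      by (rule vector_derivative_eq_imp_diff_const[OF _ dI[OF rot_in_S[OF x]]])
        (use has_vector_derivative_mult_right[OF has_vector_derivative_shift[OF dI[OF x]]] Qs in metis)
    then show ?thesis by (simp add: I0 algebra_simps)
  qed
  have "Cinf_on S (\<lambda>x. \<mu> * I (2 * pi, x))"
    by (intro Cinf_on_intros open_S Cinf_on_compose[OF I open_S US]) auto
  \<comment> \<open>With \<open>v\<close> as initial values, this equation says that
    \<open>W (2 * pi, x)\<close> equals \<open>W (0, rot (- (2 * pi * p)) x)\<close> for the
    \<open>W\<close> below.\<close>
  then obtain v where v: "Cinf_on S v"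
    "\<And>x. x \<in> S \<Longrightarrow> v (rot (- (2 * pi * p)) x) - \<mu> * v x = \<mu> * I (2 * pi, x)"
    using cohomological_equation[where r = "- (2 * pi * p)", OF _ \<open>0 < d\<close> small[folded \<mu>(1)]] by blast
  \<comment> \<open>The solution in coordinates moving with the flow. Below, \<open>y\<close>
    returns to fixed coordinates, which turns \<open>W_shift\<close> into periodicity.\<close>
  define W where "W = (\<lambda>(t, x). exp (C t) * (v x + I (t, x)))"
  have W: "Cinf_on (UNIV \<times> S) W"
    unfolding W_def split_beta
    by (intro Cinf_on_mult Cinf_on_add US Cinf_on_compose[OF expC(1) US open_UNIV]
        Cinf_on_compose[OF v(1) US open_S] Cinf_on_compose[OF I US US] Cinf_on_intros) auto
  have W_shift: "W (t + 2 * pi, x) = W (t, rot (- (2 * pi * p)) x)" if "x \<in> S" for t x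
  proof -
    have "W (t + 2 * pi, x) = exp (C t) * (\<mu> * v x + \<mu> * I (t + 2 * pi, x))"
      by (simp only: W_def C_shift exp_add \<mu>_def prod.case) (simp add: algebra_simps)
    also have "\<mu> * v x + \<mu> * I (t + 2 * pi, x) = v (rot (- (2 * pi * p)) x) + I (t, rot (- (2 * pi * p)) x)"
      using v(2)[OF that] I_shift[OF that, of t] by (simp add: algebra_simps)
    finally show ?thesis by (simp add: W_def)
  qed
  have dW: "((\<lambda>t. W (t, x)) has_vector_derivative c t * W (t, x) + h (t, rot (- (p * t)) x)) (at t)"
    if "x \<in> S" for t x
  proof -
    have e: "((\<lambda>t. exp (C t)) has_vector_derivative c t * exp (C t)) (at t)"
      using field_vector_diff_chain_at[OF C DERIV_exp] by (simp add: o_def)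
    have "((\<lambda>t. v x + I (t, x)) has_vector_derivative 0 + Q (t, x)) (at t)"
      by (intro has_vector_derivative_add has_vector_derivative_const dI that)
    from has_vector_derivative_mult[OF e this]
    have "((\<lambda>t. W (t, x)) has_vector_derivative
        exp (C t) * (0 + Q (t, x)) + c t * exp (C t) * (v x + I (t, x))) (at t)"
      by (simp add: W_def)
    moreover have "exp (C t) * (0 + Q (t, x)) + c t * exp (C t) * (v x + I (t, x))
        = c t * W (t, x) + h (t, rot (- (p * t)) x)"
      by (simp add: Q_def W_def exp_minus)
    ultimately show ?thesis by simp
  qed
  define y where "y = (\<lambda>(t, x). W (t, rot (p * t) x))"
  show ?thesis
  proof
    show "Cinf_on (UNIV \<times> S) y"
      unfolding y_def split_beta
      by (intro Cinf_on_compose[OF W US US] Cinf_on_intros Cinf_on_rot US) (auto intro!: rot_in_S)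
  next
    fix t x assume "x \<in> S"
    moreover have "- (2 * pi * p) + p * (t + 2 * pi) = p * t"
      by (simp add: algebra_simps)
    ultimately show "y (t + 2 * pi, x) = y (t, x)"
      by (simp add: y_def W_shift rot_in_S rot_rot)
  next
    fix t x assume x: "x \<in> S"
    have "((\<lambda>r. W (r + t, rot (p * t) x)) has_vector_derivative
        c t * W (t, rot (p * t) x) + h (t, rot (- (p * t)) (rot (p * t) x))) (at 0)"
      using has_vector_derivative_shift[of "\<lambda>t. W (t, _)" _ 0 t] dW[OF rot_in_S[OF x]] by simp
    then show "((\<lambda>r. y (t + r, rot (- (p * r)) x)) has_vector_derivative c t * y (t, x) + h (t, x)) (at 0)"
      by (simp add: y_def rot_rot algebra_simps)
  qed
qed

end

section \<open>Smooth functions on a neighbourhood of $SU(2)$\<close>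

text \<open>An open neighbourhood of SU(2), invariant under right multiplication by
  \<open>w3\<close>, on which the first row can be normalised.\<close>

definition row_regular :: "(complex^2^2) set"
  where "row_regular = {A. A $ 1 \<noteq> 0}"

text \<open>Right multiplication by diag(i, -i), twice the velocity of \<open>w3\<close> at 0. The
  factor 2 makes the square equal to -1 and causes the halved angles from here on.\<close>

definition w3_generator :: "complex^2^2 \<Rightarrow> complex^2^2"
  where "w3_generator A = (\<chi> i j. if j = 1 then \<i> * A $ i $ j else - \<i> * A $ i $ j)"

lemma matrix_mult_w3:
  "A ** w3 \<tau> = cos (\<tau> / 2) *\<^sub>R A + sin (\<tau> / 2) *\<^sub>R w3_generator A"
  by (simp add: vec_eq_iff matrix_matrix_mult_def w3_def w3_generator_def forall_2 sum_2
      complex_eq_iff)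

interpretation su2: circle_action w3_generator row_regular
proof (rule circle_action.intro)
  show "bounded_linear w3_generator"
    unfolding linear_conv_bounded_linear[symmetric]
    by (rule linearI) (auto simp: w3_generator_def vec_eq_iff algebra_simps)
  show "w3_generator (w3_generator x) = - x" for x
    by (simp add: w3_generator_def vec_eq_iff)
  show "open row_regular"
    unfolding row_regular_def by (intro open_Collect_neq continuous_intros)
  show "cos \<theta> *\<^sub>R x + sin \<theta> *\<^sub>R w3_generator x \<in> row_regular" if "x \<in> row_regular" for x \<theta>
  proof -
    let ?y = "x ** w3 (2 * \<theta>)"
    have "?y $ 1 $ 1 = x $ 1 $ 1 * cis \<theta>" "?y $ 1 $ 2 = x $ 1 $ 2 * cis (- \<theta>)"
      by (simp_all add: matrix_matrix_mult_def w3_def sum_2)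
    then have "?y $ 1 \<noteq> 0"
      using that by (auto simp: row_regular_def vec_eq_iff forall_2)
    then show ?thesis
      using matrix_mult_w3[of x "2 * \<theta>"] by (simp add: row_regular_def)
  qed
qed

lemma rot_eq_matrix_mult_w3: "su2.rot \<theta> A = A ** w3 (2 * \<theta>)"
  by (simp add: su2.rot_def matrix_mult_w3)

lemma open_UNIV_row_regular: "open (UNIV \<times> row_regular :: (real \<times> (complex^2^2)) set)"
  by (simp add: open_Times su2.open_S)

section \<open>The smooth retraction onto SU(2)\<close>

definition SU2_completion :: "complex^2^2 \<Rightarrow> complex^2^2"
  where "SU2_completion A = (\<chi> i j. if i = 1 then A $ 1 $ j
    else if j = 1 then - cnj (A $ 1 $ 2) else cnj (A $ 1 $ 1))"

text \<open>A unit first row (a, b) determines an element of SU(2), whose second row is (- cnj b,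
  cnj a). The completion is real linear and the factor normalises the row, so smoothness is that of
  a power of a positive function.\<close>

definition SU2_retract :: "complex^2^2 \<Rightarrow> complex^2^2"
  where "SU2_retract A = (A $ 1 \<bullet> A $ 1) powr (- 1 / 2) *\<^sub>R SU2_completion A"

lemma row_inner: "of_real ((A::complex^2^2) $ 1 \<bullet> A $ 1)
    = A $ 1 $ 1 * cnj (A $ 1 $ 1) + A $ 1 $ 2 * cnj (A $ 1 $ 2)"
  by (simp add: inner_vec_def sum_2 complex_eq_iff inner_complex_def)

lemma SU2_rows:
  assumes "A \<in> SU2"
  shows "A $ 1 \<bullet> A $ 1 = 1" "SU2_completion A = A"
proof -
  let ?a = "A $ 1 $ 1" and ?b = "A $ 1 $ 2" and ?c = "A $ 2 $ 1" and ?d = "A $ 2 $ 2"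
  have eqs: "?a * cnj ?a + ?b * cnj ?b = 1" "?c * cnj ?a + ?d * cnj ?b = 0" "?a * ?d - ?b * ?c = 1"
    using assms by (auto simp: SU2_def adjoint_mat_def matrix_matrix_mult_def mat_def vec_eq_iff
        forall_2 sum_2 det_2)
  show "A $ 1 \<bullet> A $ 1 = 1"
    using eqs(1) row_inner[of A] by (metis of_real_eq_1_iff)
  \<comment> \<open>Multiply the determinant equation by \<open>cnj ?a\<close> and
    \<open>cnj ?b\<close> respectively and eliminate with the other two.\<close>
  have "?d = cnj ?a" "?c = - cnj ?b"
    using eqs by algebra+
  then show "SU2_completion A = A"
    by (simp add: SU2_completion_def vec_eq_iff forall_2)
qed

lemma SU2_subset_row_regular: "SU2 \<subseteq> row_regular"
  using SU2_rows(1) by (force simp: row_regular_def)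

lemma SU2_retract_eq: "A \<in> SU2 \<Longrightarrow> SU2_retract A = A"
  by (simp add: SU2_retract_def SU2_rows)

lemma SU2_retract_in_SU2:
  assumes "A \<in> row_regular"
  shows "SU2_retract A \<in> SU2"
proof -
  define n where "n = A $ 1 \<bullet> A $ 1"
  define \<rho> where "\<rho> = n powr (- 1 / 2)"
  let ?a = "A $ 1 $ 1" and ?b = "A $ 1 $ 2"
  have "n > 0"
    using assms by (simp add: n_def row_regular_def)
  moreover have "\<rho> * \<rho> = n powr - 1"
    unfolding \<rho>_def powr_add[symmetric] by simp
  ultimately have "\<rho> * \<rho> * n = 1"
    by (simp add: powr_minus)
  then have "of_real (\<rho> * \<rho> * n) = (1::complex)"
    by simp
  then have 1: "of_real \<rho> * of_real \<rho> * (?a * cnj ?a + ?b * cnj ?b) = 1"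
    by (simp add: n_def row_inner)
  have "SU2_retract A = (\<chi> i j. of_real \<rho> * (if i = 1 then A $ 1 $ j
    else if j = 1 then - cnj ?b else cnj ?a))"
    by (simp add: SU2_retract_def SU2_completion_def \<rho>_def n_def vec_eq_iff scaleR_conv_of_real[where 'a = complex])
  then show ?thesis
    using 1
    by (simp add: SU2_def adjoint_mat_def matrix_matrix_mult_def mat_def vec_eq_iff
        forall_2 sum_2 det_2 algebra_simps)
qed

lemma Cinf_on_SU2_retract: "Cinf_on row_regular SU2_retract"
proof -
  have "bounded_linear SU2_completion"
    unfolding linear_conv_bounded_linear[symmetric]
    by (rule linearI) (auto simp: SU2_completion_def vec_eq_iff complex_eq_iff algebra_simps)
  then show ?thesis
    unfolding SU2_retract_def[abs_def]
    by (intro Cinf_on_scaleR su2.open_S Cinf_on_linear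
        Cinf_on_compose[OF Cinf_on_powr su2.open_S open_greaterThan]
        Cinf_on_bilinear[OF su2.open_S bounded_bilinear_inner] bounded_linear_vec_nth)
      (auto simp: row_regular_def)
qed

text \<open>The local extensions of \<open>f\<close> need not agree off SU(2), but after the
  retraction only their values on SU(2) count, so they glue.\<close>

lemma smooth_submfd_retract:
  fixes f :: "real \<times> (complex^2^2) \<Rightarrow> complex"
  assumes "smooth_submfd (UNIV \<times> SU2) f"
  shows "Cinf_on (UNIV \<times> row_regular) (\<lambda>(t, A). f (t, SU2_retract A))"
proof (rule Cinf_on_local)
  let ?g = "\<lambda>z :: real \<times> (complex^2^2). (fst z, SU2_retract (snd z))"
  have g: "Cinf_on (UNIV \<times> row_regular) ?g"
    by (intro Cinf_on_intros open_UNIV_row_regular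
        Cinf_on_compose[OF Cinf_on_SU2_retract open_UNIV_row_regular su2.open_S]) auto
  fix z :: "real \<times> (complex^2^2)" assume z: "z \<in> UNIV \<times> row_regular"
  then have "?g z \<in> UNIV \<times> SU2"
    by (auto intro: SU2_retract_in_SU2)
  then obtain U h where U: "open U" "?g z \<in> U" "Cinf_on U h" "\<And>y. y \<in> U \<inter> UNIV \<times> SU2 \<Longrightarrow> f y = h y"
    using assms unfolding smooth_submfd_def by meson
  define V where "V = (UNIV \<times> row_regular) \<inter> ?g -` U"
  have V: "open V"
    unfolding V_def
    by (rule continuous_open_preimage[OF Cinf_on_imp_continuous_on[OF g] open_UNIV_row_regular U(1)])
  have "Cinf_on V (\<lambda>z. h (?g z))"
    by (rule Cinf_on_compose[OF U(3) V U(1) Cinf_on_subset[OF g]]) (auto simp: V_def)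
  then have "Cinf_on V (\<lambda>(t, A). f (t, SU2_retract A))"
    by (rule Cinf_on_cong[OF V, rotated]) (auto simp: V_def U(4) SU2_retract_in_SU2)
  then show "\<exists>V. open V \<and> z \<in> V \<and> Cinf_on V (\<lambda>(t, A). f (t, SU2_retract A))"
    using V z U(2) by (auto simp: V_def)
qed

text \<open>The first-order part differentiates \<open>u\<close> in the direction
  \<open>(1, - (p0 / 2) *\<^sub>R w3_generator x)\<close>, which is the velocity at
  \<open>r = 0\<close> of the curve in the assumption on \<open>d\<close>.\<close>

lemma operator_P_eq:
  assumes u: "Cinf_on (UNIV \<times> row_regular) u" and x: "x \<in> row_regular"
    and d: "((\<lambda>r. u (t + r, su2.rot (- (p0 / 2 * r)) x)) has_vector_derivative d) (at 0)"
  shows "operator_P p0 \<delta> \<alpha> q s u (t, x)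
    = d - (of_real (s t) + \<i> * of_real \<delta> * of_real (q t)) * u (t, x) - \<alpha> * of_real (q t) * cnj (u (t, x))"
proof -
  define D where "D = frechet_derivative u (at (t, x))"
  have D: "(u has_derivative D) (at (t, x))"
    unfolding D_def by (rule Cinf_on_has_derivative[OF u]) (use x in auto)
  note lin = has_derivative_linear[OF D]
  have chain: "((\<lambda>r. u (g r)) has_vector_derivative D g') (at a)"
    if "(g has_vector_derivative g') (at a)" "g a = (t, x)" for g :: "real \<Rightarrow> real \<times> (complex^2^2)" and g' a
    using has_derivative_compose[OF that(1)[unfolded has_vector_derivative_def], of u D] D that(2)
    by (simp add: has_vector_derivative_def linear_scale[OF lin])
  have rot: "((\<lambda>r. su2.rot (k * r) x) has_vector_derivative k *\<^sub>R w3_generator x) (at 0)" for k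
  proof -
    have "((\<lambda>r. k * r) has_vector_derivative k) (at 0)"
      by (auto intro!: derivative_eq_intros)
    from vector_diff_chain_at[OF this su2.rot_has_vector_derivative] show ?thesis
      by (simp add: o_def)
  qed
  have "((\<lambda>\<tau>. (\<tau>, x)) has_vector_derivative (1, 0)) (at t)"
    by (intro has_vector_derivative_Pair has_vector_derivative_id has_vector_derivative_const)
  then have 1: "vector_derivative (\<lambda>\<tau>. u (\<tau>, x)) (at t) = D (1, 0)"
    by (intro vector_derivative_at chain) auto
  have "((\<lambda>\<tau>. (t, su2.rot (1 / 2 * \<tau>) x)) has_vector_derivative (0, (1 / 2) *\<^sub>R w3_generator x)) (at 0)"
    by (intro has_vector_derivative_Pair rot has_vector_derivative_const)
  from chain[OF this]
  have "((\<lambda>\<tau>. u (t, x ** w3 \<tau>)) has_vector_derivative D (0, (1 / 2) *\<^sub>R w3_generator x)) (at 0)"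
    by (simp add: rot_eq_matrix_mult_w3[symmetric]) (simp add: rot_eq_matrix_mult_w3)
  then have 2: "partial0 (\<lambda>y. u (t, y)) x = \<i> * D (0, (1 / 2) *\<^sub>R w3_generator x)"
    by (simp add: partial0_def vector_derivative_at)
  have "((\<lambda>r. t + r) has_vector_derivative 1) (at 0)"
    by (auto intro!: derivative_eq_intros)
  from chain[OF has_vector_derivative_Pair[OF this rot[of "- (p0 / 2)"]]]
  have "((\<lambda>r. u (t + r, su2.rot (- (p0 / 2 * r)) x)) has_vector_derivative
      D (1, (- (p0 / 2)) *\<^sub>R w3_generator x)) (at 0)"
    by simp
  then have "d = D (1, (- (p0 / 2)) *\<^sub>R w3_generator x)"
    using d vector_derivative_unique_at by blast
  also have "\<dots> = D ((1, 0) + (- p0) *\<^sub>R (0, (1 / 2) *\<^sub>R w3_generator x))"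
    by simp
  also have "\<dots> = D (1, 0) - p0 *\<^sub>R D (0, (1 / 2) *\<^sub>R w3_generator x)"
    by (simp only: linear_add[OF lin] linear_scale[OF lin]) simp
  finally show ?thesis
    by (simp add: operator_P_def 1 2 scaleR_conv_of_real algebra_simps)
qed

section \<open>Small divisors and solvability\<close>

text \<open>Reduce the angle to the nearest multiple of 2 pi and let x be half of the rest. The
  modulus is 2 |sin x|, and |sin x| \<ge> |x| / 3 for |x| \<le> 2 by the cubic Taylor bound.\<close>

lemma cmod_cis_minus_1_ge:
  obtains k :: int where "cmod (cis \<theta> - 1) \<ge> \<bar>\<theta> + 2 * pi * of_int k\<bar> / 3"
proof
  define k where "k = - round (\<theta> / (2 * pi))"
  define x where "x = (\<theta> + 2 * pi * of_int k) / 2"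
  have "\<bar>x / pi\<bar> \<le> 1 / 2"
    using of_int_round_abs_le[of "\<theta> / (2 * pi)"] by (simp add: x_def k_def field_simps)
  then have "\<bar>x\<bar> \<le> 2"
    using pi_less_4 by (simp add: abs_divide field_simps)
  then have "\<bar>x\<bar> ^ 2 \<le> 2 ^ 2"
    by (intro power_mono) auto
  then have "\<bar>x\<bar> * \<bar>x\<bar> ^ 2 \<le> \<bar>x\<bar> * 4"
    by (intro mult_left_mono) auto
  moreover have "\<bar>sin x - x\<bar> \<le> \<bar>x\<bar> * \<bar>x\<bar> ^ 2 / 6"
    using Maclaurin_sin_bound[of x 3]
    by (simp add: numeral_3_eq_3 sin_coeff_def fact_numeral power2_eq_square)
  ultimately have "\<bar>sin x\<bar> \<ge> \<bar>x\<bar> / 3"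
    by linarith
  moreover have "cis \<theta> = cis (2 * x)"
  proof -
    have "2 * x = \<theta> + 2 * pi * of_int k"
      by (simp add: x_def)
    then show ?thesis
      by (simp only: cis_mult[symmetric] cis_multiple_2pi[OF Ints_of_int]) simp
  qed
  moreover have "cmod (cis (2 * x) - 1) = 2 * \<bar>sin x\<bar>"
    using dist_exp_i_1[of "2 * x"] by (simp add: cis_conv_exp)
  ultimately show "cmod (cis \<theta> - 1) \<ge> \<bar>\<theta> + 2 * pi * of_int k\<bar> / 3"
    by (simp add: x_def)
qed

text \<open>Here \<open>j\<close> is \<open>2 m\<close>.\<close>

definition small_divisors :: "real \<Rightarrow> complex \<Rightarrow> bool"
  where "small_divisors p0 z \<longleftrightarrow> (\<exists>d>0. \<exists>N. \<forall>j::int.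
    cmod (cis (of_int j * (- (pi * p0))) - exp z) \<ge> d / (1 + (of_int j)\<^sup>2) ^ N)"

text \<open>\<open>exp z\<close> is off the unit circle, so the difference of the moduli is a bound
  uniform in \<open>j\<close>.\<close>

lemma small_divisors_hyperbolic:
  assumes "Re z \<noteq> 0"
  shows "small_divisors p0 z"
  unfolding small_divisors_def
proof (intro exI conjI allI)
  show "\<bar>1 - exp (Re z)\<bar> > 0"
    using assms by simp
  show "\<bar>1 - exp (Re z)\<bar> / (1 + (of_int j)\<^sup>2) ^ 0
      \<le> cmod (cis (of_int j * (- (pi * p0))) - exp z)" for j :: int
    using norm_triangle_ineq3[of "cis (of_int j * (- (pi * p0)))" "exp z"] by simp
qed

text \<open>Here \<open>exp z\<close> is on the unit circle, so the divisor is comparable to the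
  distance of an angle from the multiples of 2 pi, which \<open>dioph\<close> bounds for
  \<open>m = j / 2\<close>.\<close>

lemma small_divisors_elliptic:
  assumes "0 < M" and dioph: "\<And>l m k. l \<in> half_nats \<Longrightarrow> jbracket l \<ge> M \<Longrightarrow> m \<in> weights l \<Longrightarrow>
      \<bar>2 * pi * of_int k + 2 * pi * m * p0 - \<omega>\<bar> \<ge> jbracket l powr (- M)"
    and "\<sigma> = 1 \<or> \<sigma> = - 1"
  shows "small_divisors p0 (\<i> * of_real (\<sigma> * \<omega>))"
proof -
  define L where "L = nat \<lceil>M\<rceil>"
  have L: "real L \<ge> M"
    unfolding L_def using \<open>0 < M\<close> by linarith
  have div: "\<bar>2 * pi * of_int k + pi * of_int j * p0 - \<omega>\<bar> \<ge> (1 / (1 + real L) ^ L) / (1 + (of_int j)\<^sup>2) ^ L"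
    for j k :: int
  proof -
    \<comment> \<open>Adding \<open>L\<close> to |j| / 2 keeps j / 2 among the weights of
      \<open>l\<close> and makes \<open>jbracket l\<close> at least \<open>M\<close> even for small
      \<open>j\<close>.\<close>
    define l where "l = \<bar>of_int j :: real\<bar> / 2 + real L"
    have l: "l \<ge> M" "l \<ge> 0"
      using L by (auto simp: l_def)
    have "l = real (nat \<bar>j\<bar> + 2 * L) / 2"
      by (simp add: l_def)
    then have "l \<in> half_nats"
      unfolding half_nats_def by blast
    moreover have "jbracket l \<ge> l"
      unfolding jbracket_def by (rule real_le_rsqrt) (use l in \<open>simp add: power2_eq_square algebra_simps\<close>)
    moreover have "of_int j / 2 \<in> weights l"
    proof -
      define i where "i = nat (L + (if j \<ge> 0 then j else 0))"
      have "of_int j / 2 = - l + of_nat i" "of_nat i \<le> 2 * l"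
        by (auto simp: i_def l_def)
      then show ?thesis unfolding weights_def by blast
    qed
    ultimately have "\<bar>2 * pi * of_int k + 2 * pi * (of_int j / 2) * p0 - \<omega>\<bar> \<ge> jbracket l powr (- M)"
      using l by (intro dioph) auto
    then have "\<bar>2 * pi * of_int k + pi * of_int j * p0 - \<omega>\<bar> \<ge> jbracket l powr (- M)"
      by simp
    moreover have "jbracket l powr (- M) \<ge> (1 / (1 + real L) ^ L) / (1 + (of_int j)\<^sup>2) ^ L"
    proof -
      let ?b = "(1 + real L) * (1 + (of_int j)\<^sup>2)"
      have 1: "1 \<le> jbracket l"
        using l by (simp add: jbracket_def)
      have "jbracket l \<le> 1 + l"
        unfolding jbracket_def by (rule real_le_lsqrt) (use l in \<open>auto simp: power2_eq_square algebra_simps\<close>)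
      also have "\<dots> \<le> ?b"
      proof -
        have "\<bar>of_int j :: real\<bar> / 2 \<le> (of_int j)\<^sup>2"
        proof (cases "j = 0")
          case False
          then have "1 \<le> \<bar>of_int j :: real\<bar>"
            by linarith
          then have "\<bar>of_int j :: real\<bar> * 1 \<le> \<bar>of_int j\<bar> * \<bar>of_int j\<bar>"
            by (intro mult_left_mono) auto
          then show ?thesis by (simp add: power2_eq_square)
        qed simp
        moreover have "0 \<le> real L * (of_int j)\<^sup>2"
          by simp
        ultimately have "1 + l \<le> 1 + real L + (of_int j)\<^sup>2 + real L * (of_int j)\<^sup>2"
          unfolding l_def by linarith
        then show ?thesis
          by (simp add: algebra_simps)
      qed
      finally have "jbracket l \<le> ?b" .
      have "1 / ?b ^ L \<le> 1 / jbracket l ^ L"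
        using 1 \<open>jbracket l \<le> ?b\<close> by (intro divide_left_mono power_mono mult_pos_pos zero_less_power add_pos_nonneg) auto
      also have "\<dots> = jbracket l powr (- real L)"
        using 1 by (simp add: powr_minus powr_realpow divide_inverse)
      also have "\<dots> \<le> jbracket l powr (- M)"
        using 1 L by (intro powr_mono) auto
      finally show ?thesis by (simp add: power_mult_distrib)
    qed
    ultimately show ?thesis by linarith
  qed
  show ?thesis
    unfolding small_divisors_def
  proof (intro exI conjI allI)
    show "(1 / (1 + real L) ^ L) / 3 > 0"
      by simp
    fix j :: int
    define a where "a = of_int j * (- (pi * p0))"
    obtain k :: int where k: "cmod (cis (a - \<sigma> * \<omega>) - 1) \<ge> \<bar>a - \<sigma> * \<omega> + 2 * pi * of_int k\<bar> / 3"
      by (rule cmod_cis_minus_1_ge)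
    \<comment> \<open>The angle \<open>a\<close> carries the sign opposite to that in
      \<open>div\<close>: for \<open>\<sigma> = 1\<close> replace \<open>j\<close> by
      \<open>- j\<close>, for \<open>\<sigma> = - 1\<close> change the sign of the whole
      expression.\<close>
    have "\<bar>a - \<sigma> * \<omega> + 2 * pi * of_int k\<bar> \<ge> (1 / (1 + real L) ^ L) / (1 + (of_int j)\<^sup>2) ^ L"
      using assms(3)
    proof
      assume "\<sigma> = 1"
      then show ?thesis
        using div[of "- j" k] by (simp add: a_def algebra_simps)
    next
      assume "\<sigma> = - 1"
      then have "\<bar>a - \<sigma> * \<omega> + 2 * pi * of_int k\<bar> = \<bar>2 * pi * of_int (- k) + pi * of_int j * p0 - \<omega>\<bar>"
        by (subst abs_minus_cancel[symmetric]) (simp add: a_def algebra_simps)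
      then show ?thesis using div[of j "- k"] by simp
    qed
    moreover have "cmod (cis a - exp (\<i> * of_real (\<sigma> * \<omega>))) = cmod (cis (a - \<sigma> * \<omega>) - 1)"
    proof -
      have "cis a - exp (\<i> * of_real (\<sigma> * \<omega>)) = cis (\<sigma> * \<omega>) * (cis (a - \<sigma> * \<omega>) - 1)"
        unfolding cis_conv_exp[symmetric] by (simp add: right_diff_distrib cis_mult)
      then show ?thesis by (simp only: norm_mult norm_cis mult_1_left)
    qed
    ultimately show "(1 / (1 + real L) ^ L) / 3 / (1 + (of_int j)\<^sup>2) ^ L
        \<le> cmod (cis (of_int j * (- (pi * p0))) - exp (\<i> * of_real (\<sigma> * \<omega>)))"
      using k unfolding a_def[symmetric] by simp
  qed
qed

text \<open>A point where \<open>q\<close> is nonzero may lie outside \<open>{0..2*pi}\<close>;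
  translation moves it to the endpoint 0, and a nonnegative continuous function with zero integral
  vanishes throughout.\<close>

lemma Cinf_T_period_integral_pos:
  assumes "q \<in> Cinf_T" "\<forall>t. q t \<ge> 0" "\<exists>t. q t \<noteq> 0"
  shows "integral {0..2*pi} q > 0"
proof -
  have per: "q (t + 2 * pi) = q t" and cont: "continuous_on UNIV q" for t
    using assms(1) by (auto simp: Cinf_T_def intro: Cinf_on_imp_continuous_on)
  obtain t where t: "q t \<noteq> 0"
    using assms(3) by blast
  have shift: "integral {0..2*pi} (\<lambda>b. q (b + t)) = integral {0..2*pi} q"
    by (rule integral_periodic_shift[OF cont per]) simp
  have c: "continuous_on {0..2*pi} (\<lambda>b. q (b + t))"
    by (intro continuous_on_compose2[OF cont] continuous_intros) auto
  have "integral {0..2*pi} (\<lambda>b. q (b + t)) \<noteq> 0"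
    using integral_eq_0_iff[OF c] assms(2) t by force
  moreover have "integral {0..2*pi} (\<lambda>b. q (b + t)) \<ge> 0"
    by (intro integral_nonneg integrable_continuous_real c) (use assms(2) in auto)
  ultimately show ?thesis using shift by simp
qed

text \<open>In terms of \<open>u\<close> and its conjugate the zero-order part of the operator is the matrix
  \<open>s + q L\<close> with \<open>L\<^sup>2 = \<bar>\<alpha>\<bar>\<^sup>2 - \<delta>\<^sup>2\<close>, and \<open>cnj \<alpha> * u + (\<sigma> * \<mu> - \<i> * \<delta>) * cnj u\<close>, for \<open>\<sigma> = \<plusminus>1\<close>, are
  the eigencoordinates.\<close>

lemma operator_P_solvable:
  fixes f :: "real \<times> (complex^2^2) \<Rightarrow> complex"
  assumes "\<alpha> \<noteq> 0" and q: "q \<in> Cinf_T" and s: "s \<in> Cinf_T"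
    and \<mu>: "\<mu>\<^sup>2 = of_real ((cmod \<alpha>)\<^sup>2 - \<delta>\<^sup>2)" "\<mu> \<noteq> 0"
    and small: "\<And>\<sigma>. \<sigma> = 1 \<or> \<sigma> = - 1 \<Longrightarrow>
      small_divisors p0 (of_real (integral {0..2*pi} s) + \<sigma> * \<mu> * of_real (integral {0..2*pi} q))"
    and f: "f \<in> Cinf_T_SU2"
  obtains u where "u \<in> Cinf_T_SU2" "\<And>t x. x \<in> SU2 \<Longrightarrow> operator_P p0 \<delta> \<alpha> q s u (t, x) = f (t, x)"
proof -
  define F where "F = (\<lambda>(t, A). f (t, SU2_retract A))"
  note O = open_UNIV_row_regular
  have F: "Cinf_on (UNIV \<times> row_regular) F"
    using f smooth_submfd_retract unfolding F_def Cinf_T_SU2_def by blast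
  have F_per: "F (t + 2 * pi, A) = F (t, A)" if "A \<in> row_regular" for t A
    using f SU2_retract_in_SU2[OF that] by (simp add: F_def Cinf_T_SU2_def)
  have q': "Cinf_on UNIV q" "\<And>t. q (t + 2 * pi) = q t" and s': "Cinf_on UNIV s" "\<And>t. s (t + 2 * pi) = s t"
    using q s by (auto simp: Cinf_T_def)
  define \<beta> where "\<beta> \<sigma> = \<sigma> * \<mu> - \<i> * of_real \<delta>" for \<sigma> :: complex
  define sol where "sol \<sigma> y \<longleftrightarrow> Cinf_on (UNIV \<times> row_regular) y \<and>
      (\<forall>t. \<forall>x\<in>row_regular. y (t + 2 * pi, x) = y (t, x)) \<and>
      (\<forall>t. \<forall>x\<in>row_regular. ((\<lambda>r. y (t + r, su2.rot (- (p0 / 2 * r)) x)) has_vector_derivative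
        (of_real (s t) + \<sigma> * \<mu> * of_real (q t)) * y (t, x)
          + (cnj \<alpha> * F (t, x) + \<beta> \<sigma> * cnj (F (t, x)))) (at 0))" for \<sigma> y
  have "\<exists>y. sol \<sigma> y"
    if \<sigma>: "\<sigma> = 1 \<or> \<sigma> = - 1" for \<sigma>
  proof -
    let ?c = "\<lambda>t. of_real (s t) + \<sigma> * \<mu> * of_real (q t)"
    let ?h = "\<lambda>z. cnj \<alpha> * F z + \<beta> \<sigma> * cnj (F z)"
    have c: "Cinf_on UNIV ?c"
      by (intro Cinf_on_intros open_UNIV Cinf_on_bounded_linear[OF open_UNIV bounded_linear_of_real] q' s')
    have cp: "?c (t + 2 * pi) = ?c t" for t
      by (simp add: q' s')
    have h: "Cinf_on (UNIV \<times> row_regular) ?h"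
      by (intro Cinf_on_intros O Cinf_on_bounded_linear[OF O bounded_linear_cnj] F)
    have int: "g integrable_on {0..2*pi}" if "Cinf_on UNIV g" for g :: "real \<Rightarrow> real"
      by (intro integrable_continuous_real continuous_on_subset[OF Cinf_on_imp_continuous_on[OF that]]) simp
    have "(?c has_integral (of_real (integral {0..2*pi} s) + \<sigma> * \<mu> * of_real (integral {0..2*pi} q))) {0..2*pi}"
      by (intro has_integral_add has_integral_mult_right has_integral_of_real integrable_integral int q' s')
    then have I: "integral {0..2*pi} ?c
        = of_real (integral {0..2*pi} s) + \<sigma> * \<mu> * of_real (integral {0..2*pi} q)"
      by (rule integral_unique)
    \<comment> \<open>\<open>rot\<close> runs at half the angle of \<open>w3\<close>, so the speed
      is \<open>p0 / 2\<close>.\<close>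
    obtain d N where d: "0 < d" "\<And>j::int. cmod (cis (of_int j * (- (2 * pi * (p0 / 2))))
        - exp (integral {0..2*pi} ?c)) \<ge> d / (1 + (of_int j)\<^sup>2) ^ N"
      using small[OF \<sigma>] unfolding small_divisors_def I by auto
    have hp: "?h (t + 2 * pi, x) = ?h (t, x)" if "x \<in> row_regular" for t x
      by (simp add: F_per[OF that])
    show ?thesis
      unfolding sol_def by (rule su2.transport_equation[OF c cp h hp d]) blast+
  qed
  then have "\<exists>y. \<forall>\<sigma>. \<sigma> = 1 \<or> \<sigma> = - 1 \<longrightarrow> sol \<sigma> (y \<sigma>)"
    by metis
  then obtain y where sol: "\<And>\<sigma>. \<sigma> = 1 \<or> \<sigma> = - 1 \<Longrightarrow> sol \<sigma> (y \<sigma>)"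
    by blast
  note y = sol[unfolded sol_def, THEN conjunct1]
    sol[unfolded sol_def, THEN conjunct2, THEN conjunct1, rule_format]
    sol[unfolded sol_def, THEN conjunct2, THEN conjunct2, rule_format]
  \<comment> \<open>\<open>v1\<close> and \<open>v2\<close> invert the eigencoordinates:
    \<open>y \<sigma>\<close> is \<open>cnj \<alpha> * v1 + \<beta> \<sigma> * v2\<close>. They
    stand for \<open>u\<close> and its conjugate.\<close>
  define v2 where "v2 z = (y 1 z - y (- 1) z) * (1 / (2 * \<mu>))" for z
  define v1 where "v1 z = (y 1 z + y (- 1) z + 2 * \<i> * of_real \<delta> * v2 z) * (1 / (2 * cnj \<alpha>))" for z
  \<comment> \<open>Nothing forces \<open>v2\<close> to be the conjugate of \<open>v1\<close>. But
    the system is invariant under exchanging the two unknowns and conjugating both, so averaging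
    over this symmetry gives a solution of the required form.\<close>
  define u where "u z = (v1 z + cnj (v2 z)) * (1 / 2)" for z
  have v2: "Cinf_on (UNIV \<times> row_regular) v2"
    unfolding v2_def[abs_def] by (intro Cinf_on_intros O y) auto
  have v1: "Cinf_on (UNIV \<times> row_regular) v1"
    unfolding v1_def[abs_def] by (intro Cinf_on_intros O y v2) auto
  have u: "Cinf_on (UNIV \<times> row_regular) u"
    unfolding u_def[abs_def]
    by (intro Cinf_on_intros O Cinf_on_bounded_linear[OF O bounded_linear_cnj] v1 v2)
  have u_per: "u (t + 2 * pi, x) = u (t, x)" if "x \<in> row_regular" for t x
    using that by (simp add: u_def v1_def v2_def y(2))
  have \<mu>\<alpha>: "\<mu>\<^sup>2 + (of_real \<delta>)\<^sup>2 = \<alpha> * cnj \<alpha>"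
    unfolding \<mu>(1) by (subst complex_norm_square[symmetric]) simp
  have du: "((\<lambda>r. u (t + r, su2.rot (- (p0 / 2 * r)) x)) has_vector_derivative
      (of_real (s t) + \<i> * of_real \<delta> * of_real (q t)) * u (t, x)
        + \<alpha> * of_real (q t) * cnj (u (t, x)) + F (t, x)) (at 0)" if x: "x \<in> row_regular" for t x
  proof -
    let ?g = "\<lambda>r. (t + r, su2.rot (- (p0 / 2 * r)) x)"
    let ?z = "(t, x)"
    let ?s = "of_real (s t) :: complex" and ?q = "of_real (q t) :: complex" and ?\<delta> = "of_real \<delta> :: complex"
    have ys: "((\<lambda>r. y 1 (?g r)) has_vector_derivative
        (?s + 1 * \<mu> * ?q) * y 1 ?z + (cnj \<alpha> * F ?z + \<beta> 1 * cnj (F ?z))) (at 0)"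
      "((\<lambda>r. y (- 1) (?g r)) has_vector_derivative
        (?s + - 1 * \<mu> * ?q) * y (- 1) ?z + (cnj \<alpha> * F ?z + \<beta> (- 1) * cnj (F ?z))) (at 0)"
      by (intro y(3) x; simp)+
    define d2 where "d2 = ?s * v2 ?z + ?q * (cnj \<alpha> * v1 ?z - \<i> * ?\<delta> * v2 ?z) + cnj (F ?z)"
    define d1 where "d1 = ?s * v1 ?z + ?q * (\<i> * ?\<delta> * v1 ?z + \<alpha> * v2 ?z) + F ?z"
    have ya: "y 1 ?z = cnj \<alpha> * v1 ?z + \<beta> 1 * v2 ?z" and yb: "y (- 1) ?z = cnj \<alpha> * v1 ?z + \<beta> (- 1) * v2 ?z"
      using \<open>\<alpha> \<noteq> 0\<close> \<mu>(2) by (simp_all add: v1_def v2_def \<beta>_def field_simps)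
    have "((\<lambda>r. v2 (?g r)) has_vector_derivative
        (((?s + 1 * \<mu> * ?q) * y 1 ?z + (cnj \<alpha> * F ?z + \<beta> 1 * cnj (F ?z)))
        - ((?s + - 1 * \<mu> * ?q) * y (- 1) ?z + (cnj \<alpha> * F ?z + \<beta> (- 1) * cnj (F ?z)))) * (1 / (2 * \<mu>))) (at 0)"
      unfolding v2_def by (intro has_vector_derivative_mult_left has_vector_derivative_diff ys)
    moreover have "(((?s + 1 * \<mu> * ?q) * y 1 ?z + (cnj \<alpha> * F ?z + \<beta> 1 * cnj (F ?z)))
        - ((?s + - 1 * \<mu> * ?q) * y (- 1) ?z + (cnj \<alpha> * F ?z + \<beta> (- 1) * cnj (F ?z)))) * (1 / (2 * \<mu>)) = d2"
      unfolding ya yb d2_def \<beta>_def using \<mu>(2) by (simp add: field_simps)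
    ultimately have dv2: "((\<lambda>r. v2 (?g r)) has_vector_derivative d2) (at 0)"
      by simp
    have "((\<lambda>r. v1 (?g r)) has_vector_derivative
        (((?s + 1 * \<mu> * ?q) * y 1 ?z + (cnj \<alpha> * F ?z + \<beta> 1 * cnj (F ?z)))
        + ((?s + - 1 * \<mu> * ?q) * y (- 1) ?z + (cnj \<alpha> * F ?z + \<beta> (- 1) * cnj (F ?z)))
        + 2 * \<i> * ?\<delta> * d2) * (1 / (2 * cnj \<alpha>))) (at 0)"
      unfolding v1_def
      by (intro has_vector_derivative_mult_left has_vector_derivative_mult_right
          has_vector_derivative_add ys dv2)
    moreover have "(((?s + 1 * \<mu> * ?q) * y 1 ?z + (cnj \<alpha> * F ?z + \<beta> 1 * cnj (F ?z)))
        + ((?s + - 1 * \<mu> * ?q) * y (- 1) ?z + (cnj \<alpha> * F ?z + \<beta> (- 1) * cnj (F ?z)))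
        + 2 * \<i> * ?\<delta> * d2) = 2 * cnj \<alpha> * (?s * v1 ?z + ?q * (\<i> * ?\<delta> * v1 ?z) + F ?z)
          + 2 * ?q * v2 ?z * (\<mu>\<^sup>2 + ?\<delta>\<^sup>2)"
      unfolding ya yb d2_def \<beta>_def by (simp add: algebra_simps power2_eq_square)
    moreover have "(2 * cnj \<alpha> * (?s * v1 ?z + ?q * (\<i> * ?\<delta> * v1 ?z) + F ?z)
          + 2 * ?q * v2 ?z * (\<mu>\<^sup>2 + ?\<delta>\<^sup>2)) * (1 / (2 * cnj \<alpha>)) = d1"
      unfolding \<mu>\<alpha> d1_def using \<open>\<alpha> \<noteq> 0\<close> by (simp add: field_simps)
    ultimately have dv1: "((\<lambda>r. v1 (?g r)) has_vector_derivative d1) (at 0)"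
      by simp
    have "((\<lambda>r. u (?g r)) has_vector_derivative (d1 + cnj d2) * (1 / 2)) (at 0)"
      unfolding u_def
      by (intro has_vector_derivative_mult_left has_vector_derivative_add dv1
          bounded_linear.has_vector_derivative[OF bounded_linear_cnj] dv2)
    moreover have "(d1 + cnj d2) * (1 / 2) = (?s + \<i> * ?\<delta> * ?q) * u ?z + \<alpha> * ?q * cnj (u ?z) + F ?z"
      by (simp add: d1_def d2_def u_def field_simps)
    ultimately show ?thesis by (simp only:)
  qed
  show ?thesis
  proof
    have "smooth_submfd (UNIV \<times> SU2) u"
      unfolding smooth_submfd_def
      using O u SU2_subset_row_regular by blast
    then show "u \<in> Cinf_T_SU2"
      using u_per SU2_subset_row_regular by (auto simp: Cinf_T_SU2_def)
  next
    fix t x assume x: "x \<in> SU2"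
    then have "x \<in> row_regular"
      using SU2_subset_row_regular by blast
    from operator_P_eq[OF u this du[OF this]]
    show "operator_P p0 \<delta> \<alpha> q s u (t, x) = f (t, x)"
      using x by (simp add: F_def SU2_retract_eq)
  qed
qed

section \<open>From the four conditions to bounds on the divisors\<close>

theorem theorem6p2:
  fixes p0 \<delta> s0 q0 :: real and \<alpha> A0 B0 :: complex and q s :: "real \<Rightarrow> real"
  assumes "\<alpha> \<noteq> 0"
    and "q \<in> Cinf_T" and "s \<in> Cinf_T"
    and "\<forall>t. q t \<ge> 0" and "\<exists>t. q t \<noteq> 0"
    and "s0 = integral {0..2*pi} s"
    and "q0 = integral {0..2*pi} q"
    and "A0 = of_real s0 + \<i> * of_real \<delta> * of_real q0"
    and "B0 = \<alpha> * of_real q0"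
    and "cmod B0 > cmod A0
      \<or> (cmod B0 \<le> cmod A0 \<and> cmod \<alpha> > \<bar>\<delta>\<bar> \<and>
          \<not> (\<exists>m\<in>half_ints. \<exists>k::int. resonant p0 A0 B0 m k))
      \<or> (cmod \<alpha> < \<bar>\<delta>\<bar> \<and> s0 \<noteq> 0)
      \<or> (cmod \<alpha> < \<bar>\<delta>\<bar> \<and> s0 = 0 \<and>
          \<not> (\<exists>m\<in>half_ints. \<exists>k::int. resonant p0 A0 B0 m k) \<and>
          (\<exists>M::real. M > 0 \<and>
            (\<forall>l\<in>half_nats. jbracket l \<ge> M \<longrightarrow>
              (\<forall>m\<in>weights l. \<forall>k::int.
                \<bar>2 * pi * of_int k + 2 * pi * m * p0 - q0 * sqrt (\<delta>\<^sup>2 - (cmod \<alpha>)\<^sup>2)\<bar>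
                  \<ge> jbracket l powr (- M)))))"
  shows "\<forall>f\<in>Cinf_T_SU2. \<exists>u\<in>Cinf_T_SU2.
           \<forall>t. \<forall>x\<in>SU2. operator_P p0 \<delta> \<alpha> q s u (t, x) = f (t, x)"
proof
  fix f assume f: "f \<in> Cinf_T_SU2"
  have q0: "q0 > 0"
    unfolding assms(7) by (rule Cinf_T_period_integral_pos[OF assms(2,4,5)])
  \<comment> \<open>The eigenvalues of the coupling matrix are \<plusminus>\<mu>, real for
    \<open>cmod \<alpha> > \<bar>\<delta>\<bar>\<close> and imaginary for the reverse
    inequality.\<close>
  define \<mu> where "\<mu> = csqrt (of_real ((cmod \<alpha>)\<^sup>2 - \<delta>\<^sup>2))"
  have A0: "(cmod A0)\<^sup>2 = s0\<^sup>2 + \<delta>\<^sup>2 * q0\<^sup>2"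
    unfolding assms(8) cmod_power2 by (simp add: power_mult_distrib)
  have B0: "(cmod B0)\<^sup>2 = (cmod \<alpha>)\<^sup>2 * q0\<^sup>2"
    unfolding assms(9) by (simp add: norm_mult power_mult_distrib)
  \<comment> \<open>The real parts are \<open>s0 + w * q0\<close> and \<open>s0 - w * q0\<close>,
    whose product is |A0|^2 - |B0|^2.\<close>
  have hyperbolic: "\<mu> \<noteq> 0 \<and> (\<forall>\<sigma>. \<sigma> = 1 \<or> \<sigma> = - 1 \<longrightarrow> small_divisors p0 (of_real s0 + \<sigma> * \<mu> * of_real q0))"
    if "cmod \<alpha> > \<bar>\<delta>\<bar>" "(cmod A0)\<^sup>2 \<noteq> (cmod B0)\<^sup>2"
  proof -
    have "\<delta>\<^sup>2 < (cmod \<alpha>)\<^sup>2"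
      using that(1) by (metis abs_ge_zero power2_abs power_strict_mono pos2)
    then have pos: "(cmod \<alpha>)\<^sup>2 - \<delta>\<^sup>2 > 0"
      by simp
    define w where "w = sqrt ((cmod \<alpha>)\<^sup>2 - \<delta>\<^sup>2)"
    have w: "\<mu> = of_real w" "w > 0" "w\<^sup>2 = (cmod \<alpha>)\<^sup>2 - \<delta>\<^sup>2"
      using pos by (simp_all add: \<mu>_def w_def of_real_sqrt[symmetric])
    have "s0\<^sup>2 \<noteq> (w * q0)\<^sup>2"
      using that(2) unfolding A0 B0 power_mult_distrib w(3) by (simp add: algebra_simps)
    then have "s0 + w * q0 \<noteq> 0" "s0 - w * q0 \<noteq> 0"
      by (auto simp: power2_eq_iff)
    then have "small_divisors p0 (of_real s0 + \<sigma> * \<mu> * of_real q0)" if "\<sigma> = 1 \<or> \<sigma> = - 1" for \<sigma>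
      using that by (intro small_divisors_hyperbolic) (auto simp: w(1))
    then show ?thesis using w by auto
  qed
  have small: "\<mu> \<noteq> 0 \<and> (\<forall>\<sigma>. \<sigma> = 1 \<or> \<sigma> = - 1 \<longrightarrow> small_divisors p0 (of_real s0 + \<sigma> * \<mu> * of_real q0))"
  proof (cases "cmod \<alpha> < \<bar>\<delta>\<bar>")
    case True
    then have "(cmod \<alpha>)\<^sup>2 < \<delta>\<^sup>2"
      by (metis norm_ge_zero power2_abs power_strict_mono pos2)
    then have pos: "\<delta>\<^sup>2 - (cmod \<alpha>)\<^sup>2 > 0"
      by simp
    define w where "w = sqrt (\<delta>\<^sup>2 - (cmod \<alpha>)\<^sup>2)"
    have w: "\<mu> = \<i> * of_real w" "w > 0"
      using pos csqrt_of_real_nonpos[of "of_real ((cmod \<alpha>)\<^sup>2 - \<delta>\<^sup>2)"]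
      by (simp_all add: \<mu>_def w_def)
    have "(cmod \<alpha>)\<^sup>2 * q0\<^sup>2 < \<delta>\<^sup>2 * q0\<^sup>2"
      using pos q0 by (intro mult_strict_right_mono) auto
    then have "(cmod B0)\<^sup>2 < (cmod A0)\<^sup>2"
      unfolding A0 B0 using zero_le_power2[of s0] by linarith
    \<comment> \<open>Condition (1) is thus excluded and (2) contradicts the case, so (3) or (4)
      holds.\<close>
    then have "\<not> cmod B0 > cmod A0"
      by (meson norm_ge_zero not_le power_mono less_imp_le)
    then have "s0 \<noteq> 0 \<or> s0 = 0 \<and> (\<exists>M>0. \<forall>l\<in>half_nats. jbracket l \<ge> M \<longrightarrow> (\<forall>m\<in>weights l. \<forall>k::int.
        \<bar>2 * pi * of_int k + 2 * pi * m * p0 - q0 * w\<bar> \<ge> jbracket l powr (- M)))"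
      using assms(10) True unfolding w_def by auto
    then consider "s0 \<noteq> 0" | M where "s0 = 0" "M > 0"
      "\<And>l m k. l \<in> half_nats \<Longrightarrow> jbracket l \<ge> M \<Longrightarrow> m \<in> weights l \<Longrightarrow>
        \<bar>2 * pi * of_int k + 2 * pi * m * p0 - q0 * w\<bar> \<ge> jbracket l powr (- M)"
      by blast
    then have "small_divisors p0 (of_real s0 + \<sigma> * \<mu> * of_real q0)" if "\<sigma> = 1 \<or> \<sigma> = - 1" for \<sigma>
    proof cases
      case 1
      then show ?thesis
        using that by (intro small_divisors_hyperbolic) (auto simp: w(1))
    next
      case 2
      have "small_divisors p0 (\<i> * of_real (1 * (q0 * w)))" "small_divisors p0 (\<i> * of_real (- 1 * (q0 * w)))"
        by (intro small_divisors_elliptic[OF 2(2,3)]; simp)+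
      then show ?thesis
        using that 2(1) by (auto simp: w(1) mult_ac)
    qed
    then show ?thesis using w by auto
  next
    case False
    with assms(10) consider "cmod B0 > cmod A0" |
      "cmod B0 \<le> cmod A0" "cmod \<alpha> > \<bar>\<delta>\<bar>" "\<not> (\<exists>m\<in>half_ints. \<exists>k::int. resonant p0 A0 B0 m k)"
      by auto
    then show ?thesis
    proof cases
      case 1
      \<comment> \<open>Condition (1) forces \<open>cmod \<alpha> > \<bar>\<delta>\<bar>\<close>,
        since s0^2 only enlarges |A0|^2.\<close>
      then have "(cmod A0)\<^sup>2 < (cmod B0)\<^sup>2"
        by (intro power_strict_mono) auto
      moreover from this have "\<delta>\<^sup>2 * q0\<^sup>2 < (cmod \<alpha>)\<^sup>2 * q0\<^sup>2"
        unfolding A0 B0 using zero_le_power2[of s0] by linarith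
      then have "\<bar>\<delta>\<bar>\<^sup>2 < (cmod \<alpha>)\<^sup>2"
        using q0 by simp
      then have "\<bar>\<delta>\<bar> < cmod \<alpha>"
        by (rule power2_less_imp_less) simp
      ultimately show ?thesis by (intro hyperbolic) auto
    next
      case 2
      have "0 \<in> half_ints"
        unfolding half_ints_def by (rule image_eqI[of _ _ 0]) auto
      \<comment> \<open>Resonance at (0, 0) is the equality of |A0| and |B0|.\<close>
      then have "\<not> resonant p0 A0 B0 0 0"
        using 2(3) by blast
      then have "(cmod A0)\<^sup>2 \<noteq> (cmod B0)\<^sup>2"
        by (simp add: resonant_def)
      then show ?thesis using 2(2) by (intro hyperbolic)
    qed
  qed
  have "\<mu>\<^sup>2 = of_real ((cmod \<alpha>)\<^sup>2 - \<delta>\<^sup>2)"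
    by (simp add: \<mu>_def)
  then obtain u where "u \<in> Cinf_T_SU2" "\<And>t x. x \<in> SU2 \<Longrightarrow> operator_P p0 \<delta> \<alpha> q s u (t, x) = f (t, x)"
    using operator_P_solvable[OF assms(1-3) _ _ _ f, of \<mu> \<delta> p0] small unfolding assms(6,7) by blast
  then show "\<exists>u\<in>Cinf_T_SU2. \<forall>t. \<forall>x\<in>SU2. operator_P p0 \<delta> \<alpha> q s u (t, x) = f (t, x)"
    by blast
qed

end
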